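(* Let $A\in\mathbb{R}^{n\times n}$ be symmetric with eigenvalues $\alpha_1\ge\cdots\ge\alpha_n$, $g\in\mathbb{R}^n$ nonzero, $\Delta>0$, and consider the TRS of minimizing $\frac12x^TAx+x^Tg$ subject to $\|x\|\le\Delta$, in the easy case. With the notation of the context, suppose $\|x_{opt}\|=\|x_k\|=\Delta$, $k\in\{1,\ldots,k_{\max}\}$, and let $y=(y_1^T,y_2^T)^T$ be a unit-length eigenvector of $M$ associated with $\lambda_{opt}$. Then $$\lambda_{opt}-\lambda_k\le2s_k\Big(1+\frac{2\|y_1\|k\sqrt\kappa}{\|y_2\|\|A_{opt}\|}\Big)\Big(\frac{\sqrt\kappa-1}{\sqrt\kappa+1}\Big)^{2k},\qquad s_k=\frac{\|A_{opt}^{-1}x_{opt}\|}{\|g\|e_1^T(T_k+\lambda_{opt}I)^{-3}e_1}.$$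
   Context: Norms are Euclidean (spectral norm for matrices). $x_{opt}$ is a global minimizer of the TRS with multiplier $\lambda_{opt}\ge0$ ($(A+\lambda_{opt}I)x_{opt}=-g$, $\lambda_{opt}(\Delta-\|x_{opt}\|)=0$, $A+\lambda_{opt}I\succeq0$); easy case: $\lambda_{opt}>-\alpha_n$. $A_{opt}=A+\lambda_{opt}I$, $\kappa=(\alpha_1+\lambda_{opt})/(\alpha_n+\lambda_{opt})$. $M=\begin{pmatrix}-A&gg^T/\Delta^2\\ I&-A\end{pmatrix}$. Lanczos on $A$ with start $g$: $Q_k=[q_1,\ldots,q_k]$ orthonormal basis of $\mathrm{span}\{g,\ldots,A^{k-1}g\}$, $q_1=g/\|g\|$, $T_k=Q_k^TAQ_k$ tridiagonal, $AQ_k=Q_kT_k+\beta_kq_{k+1}e_k^T$; $k_{\max}$ the first breakdown step. GLTR: $x_k=Q_kh_k$, $h_k$ minimizes $\frac12h^TT_kh+\|g\|h^Te_1$ over $\|h\|\le\Delta$, multiplier $\lambda_k\ge0$ with $(T_k+\lambda_kI)h_k=-\|g\|e_1$, $\lambda_k(\Delta-\|h_k\|)=0$, $T_k+\lambda_kI\succeq0$. *)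

theory Defs
  imports "Jordan_Normal_Form.Char_Poly"
begin

text \<open>Matrices and vectors are Jordan_Normal_Form matrices/vectors over the reals,
  so that objects of varying size (A is n x n, T_k is k x k, M is 2n x 2n) can coexist.\<close>

definition vnorm :: "real vec \<Rightarrow> real" where
  "vnorm v = sqrt (v \<bullet> v)"

definition opnorm :: "real mat \<Rightarrow> real" where
  "opnorm B = Sup {vnorm (B *\<^sub>v x) | x. x \<in> carrier_vec (dim_col B) \<and> vnorm x \<le> 1}"

definition symmetric_mat :: "nat \<Rightarrow> real mat \<Rightarrow> bool" where
  "symmetric_mat n B \<longleftrightarrow> B \<in> carrier_mat n n \<and> transpose_mat B = B"

definition psd_mat :: "nat \<Rightarrow> real mat \<Rightarrow> bool" where
  "psd_mat n B \<longleftrightarrow> (\<forall>z \<in> carrier_vec n. z \<bullet> (B *\<^sub>v z) \<ge> 0)"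

definition max_eig :: "real mat \<Rightarrow> real" where
  "max_eig B = Max {a. eigenvalue B a}"
definition min_eig :: "real mat \<Rightarrow> real" where
  "min_eig B = Min {a. eigenvalue B a}"

definition mat_inv :: "real mat \<Rightarrow> real mat" where
  "mat_inv B = (SOME C. C \<in> carrier_mat (dim_col B) (dim_row B) \<and> inverts_mat B C \<and> inverts_mat C B)"

definition lspan :: "nat \<Rightarrow> (nat \<Rightarrow> real vec) \<Rightarrow> nat \<Rightarrow> real vec set" where
  "lspan n v j = {vec n (\<lambda>i. \<Sum>l<j. c l * (v l $ i)) | c. True}"

definition krylov :: "nat \<Rightarrow> real mat \<Rightarrow> real vec \<Rightarrow> nat \<Rightarrow> real vec set" where
  "krylov n B g j = lspan n (\<lambda>l. (B ^\<^sub>m l) *\<^sub>v g) j"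

text \<open>k_max: the first breakdown step of Lanczos, i.e. the least k \<ge> 1 with A^k g in the k-th Krylov space.\<close>
definition kmax :: "nat \<Rightarrow> real mat \<Rightarrow> real vec \<Rightarrow> nat" where
  "kmax n B g = (LEAST k. k \<ge> 1 \<and> (B ^\<^sub>m k) *\<^sub>v g \<in> krylov n B g k)"

text \<open>Lanczos vectors q_1,...,q_k (stored as q 0, ..., q (k-1)): orthonormal, q_1 = g/||g||,
  and span{q_1..q_j} = span{g,..,A^(j-1) g} for j = 1..k.\<close>
definition lanczos_vecs :: "nat \<Rightarrow> real mat \<Rightarrow> real vec \<Rightarrow> nat \<Rightarrow> (nat \<Rightarrow> real vec) \<Rightarrow> bool" where
  "lanczos_vecs n B g k q \<longleftrightarrow>
     (\<forall>i<k. q i \<in> carrier_vec n) \<and>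
     (\<forall>i<k. \<forall>j<k. q i \<bullet> q j = (if i = j then 1 else 0)) \<and>
     q 0 = (1 / vnorm g) \<cdot>\<^sub>v g \<and>
     (\<forall>j \<in> {1..k}. lspan n q j = krylov n B g j)"

definition Qmat :: "nat \<Rightarrow> nat \<Rightarrow> (nat \<Rightarrow> real vec) \<Rightarrow> real mat" where
  "Qmat n k q = mat_of_cols n (map q [0..<k])"

definition Tmat :: "nat \<Rightarrow> nat \<Rightarrow> (nat \<Rightarrow> real vec) \<Rightarrow> real mat \<Rightarrow> real mat" where
  "Tmat n k q B = transpose_mat (Qmat n k q) * B * Qmat n k q"

definition trs_obj :: "real mat \<Rightarrow> real vec \<Rightarrow> real vec \<Rightarrow> real" where
  "trs_obj B c x = 1/2 * (x \<bullet> (B *\<^sub>v x)) + x \<bullet> c"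

definition trs_global_min :: "nat \<Rightarrow> real mat \<Rightarrow> real vec \<Rightarrow> real \<Rightarrow> real vec \<Rightarrow> bool" where
  "trs_global_min n B c \<Delta> x \<longleftrightarrow> x \<in> carrier_vec n \<and> vnorm x \<le> \<Delta> \<and>
     (\<forall>z \<in> carrier_vec n. vnorm z \<le> \<Delta> \<longrightarrow> trs_obj B c x \<le> trs_obj B c z)"

definition trs_multiplier :: "nat \<Rightarrow> real mat \<Rightarrow> real vec \<Rightarrow> real \<Rightarrow> real vec \<Rightarrow> real \<Rightarrow> bool" where
  "trs_multiplier n B c \<Delta> x l \<longleftrightarrow> l \<ge> 0 \<and>
     (B + l \<cdot>\<^sub>m 1\<^sub>m n) *\<^sub>v x = - c \<and> l * (\<Delta> - vnorm x) = 0 \<and> psd_mat n (B + l \<cdot>\<^sub>m 1\<^sub>m n)"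

definition Mmat :: "nat \<Rightarrow> real mat \<Rightarrow> real vec \<Rightarrow> real \<Rightarrow> real mat" where
  "Mmat n B g \<Delta> = four_block_mat (- B) ((1 / \<Delta>^2) \<cdot>\<^sub>m mat n n (\<lambda>(i,j). g $ i * g $ j))
                                 (1\<^sub>m n) (- B)"

end

theory Submission
  imports Defs
begin

text \<open>
  Put \<open>B = A + \<lambda>\<^sub>o\<^sub>p\<^sub>t I\<close>, \<open>T = T\<^sub>k + \<lambda>\<^sub>o\<^sub>p\<^sub>t I\<close> and \<open>c = \<parallel>g\<parallel> e\<^sub>1\<close>. The function
  \<open>\<mu> \<mapsto> \<parallel>(T + \<mu> I)\<^sup>-\<^sup>1 c\<parallel>\<^sup>2\<close> is convex and takes the value \<open>\<Delta>\<^sup>2 = g \<bullet> B\<^sup>-\<^sup>2 g\<close> at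
  \<open>\<lambda>\<^sub>k - \<lambda>\<^sub>o\<^sub>p\<^sub>t\<close>, so its tangent at 0 bounds \<open>\<lambda>\<^sub>o\<^sub>p\<^sub>t - \<lambda>\<^sub>k\<close> by
  \<open>(g \<bullet> B\<^sup>-\<^sup>2 g - c \<bullet> T\<^sup>-\<^sup>2 c) / (2 c \<bullet> T\<^sup>-\<^sup>3 c)\<close>. The numerator is the error of the
  k-point Gauss quadrature for \<open>1/t\<^sup>2\<close>, which is exact in degrees at most \<open>2k - 1\<close>. If P is the
  Chebyshev polynomial of degree 2k for the spectral interval, with \<open>N = P(0)\<close> and \<open>D = - P'(0)\<close>,
  then \<open>(N\<^sup>2 - (N + D t) P(t)) / t\<^sup>2\<close> is a polynomial of degree at most \<open>2k - 1\<close>, so only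
  \<open>(N + D t) P(t) / (N\<^sup>2 t\<^sup>2)\<close> contributes to the error. On the interval \<open>\<bar>P\<bar> \<le> 1\<close>, while
  \<open>1/N \<le> 2 \<rho>\<^sup>2\<^sup>k\<close> with \<open>\<rho> = (\<surd>\<kappa> - 1) / (\<surd>\<kappa> + 1)\<close>, and \<open>D/N \<le> 2k \<surd>\<kappa> / \<parallel>B\<parallel>\<close>.
  The vector y enters only through \<open>\<parallel>y\<^sub>1\<parallel> / \<parallel>y\<^sub>2\<parallel>\<close>, because \<open>y\<^sub>1\<close> and \<open>y\<^sub>2\<close> are the same multiple of
  \<open>B\<^sup>-\<^sup>1 g\<close> and \<open>B\<^sup>-\<^sup>2 g\<close>.
\<close>

section \<open>Chebyshev polynomials\<close>

text \<open>\<open>chebU x n\<close> is the Chebyshev polynomial of the second kind of index \<open>n - 1\<close>.\<close>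
fun chebT :: "'a::comm_ring_1 \<Rightarrow> nat \<Rightarrow> 'a" and chebU :: "'a \<Rightarrow> nat \<Rightarrow> 'a" where
  "chebT x 0 = 1"
| "chebT x (Suc n) = x * chebT x n + (x * x - 1) * chebU x n"
| "chebU x 0 = 0"
| "chebU x (Suc n) = chebT x n + x * chebU x n"

lemma chebT_chebU_add:
  shows "chebT x (m + n) = chebT x m * chebT x n + (x * x - 1) * (chebU x m * chebU x n)"
    and "chebU x (m + n) = chebU x m * chebT x n + chebT x m * chebU x n"
proof (induction m)
  case (Suc m)
  show "chebT x (Suc m + n)
      = chebT x (Suc m) * chebT x n + (x * x - 1) * (chebU x (Suc m) * chebU x n)"
    by (simp only: add_Suc chebT.simps chebU.simps Suc) (simp add: algebra_simps)
  show "chebU x (Suc m + n) = chebU x (Suc m) * chebT x n + chebT x (Suc m) * chebU x n"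
    by (simp only: add_Suc chebT.simps chebU.simps Suc) (simp add: algebra_simps)
qed auto

lemma chebT_chebU_pell:
  "chebT x n * chebT x n - (x * x - 1) * (chebU x n * chebU x n) = 1"
proof (induction n)
  case (Suc n)
  have "chebT x (Suc n) * chebT x (Suc n) - (x * x - 1) * (chebU x (Suc n) * chebU x (Suc n))
      = chebT x n * chebT x n - (x * x - 1) * (chebU x n * chebU x n)"
    by (simp add: algebra_simps)
  then show ?case using Suc by simp
qed simp

lemma chebT_double:
  shows "1 + chebT x (2 * n) = 2 * (chebT x n * chebT x n)"
    and "1 - chebT x (2 * n) = 2 * (1 - x * x) * (chebU x n * chebU x n)"
proof -
  let ?TT = "chebT x n * chebT x n" and ?UU = "(x * x - 1) * (chebU x n * chebU x n)"
  have "1 + chebT x (2 * n) = (?TT - ?UU) + (?TT + ?UU)"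
    and "1 - chebT x (2 * n) = (?TT - ?UU) - (?TT + ?UU)"
    by (simp_all only: chebT_chebU_pell chebT_chebU_add mult_2[of n])
  then show "1 + chebT x (2 * n) = 2 * ?TT"
    and "1 - chebT x (2 * n) = 2 * (1 - x * x) * (chebU x n * chebU x n)"
    by (simp_all add: algebra_simps)
qed

lemma
  fixes x :: "'a::linordered_idom"
  assumes "1 \<le> x"
  shows chebT_ge_1: "1 \<le> chebT x n" and chebU_nonneg: "0 \<le> chebU x n"
proof (induction n)
  case (Suc n)
  have "1 * 1 \<le> x * chebT x n" using assms Suc by (intro mult_mono) auto
  moreover have "0 \<le> (x * x - 1) * chebU x n"
    using assms Suc mult_mono[of 1 x 1 x] by (intro mult_nonneg_nonneg) auto
  ultimately show "1 \<le> chebT x (Suc n)" by simp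
  show "0 \<le> chebU x (Suc n)"
    using assms Suc by simp
qed auto

lemma chebT_chebU_closed_form:
  fixes r :: "'a::field_char_0"
  assumes "r \<noteq> 0"
  shows "chebT ((r + 1 / r) / 2) n = (r ^ n + 1 / r ^ n) / 2"
    and "(1 / r - r) * chebU ((r + 1 / r) / 2) n = 1 / r ^ n - r ^ n"
proof (induction n)
  case (Suc n)
  let ?x = "(r + 1 / r) / 2"
  have discriminant: "?x * ?x - 1 = ((1 / r - r) / 4) * (1 / r - r)"
    using assms by (simp add: field_simps)
  have "chebT ?x (Suc n) = ?x * chebT ?x n + (1 / r - r) / 4 * ((1 / r - r) * chebU ?x n)"
    by (simp only: chebT.simps discriminant mult.assoc)
  also have "\<dots> = (r ^ Suc n + 1 / r ^ Suc n) / 2"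
    using assms by (simp only: Suc) (simp add: field_simps)
  finally show "chebT ?x (Suc n) = (r ^ Suc n + 1 / r ^ Suc n) / 2" .
  have "(1 / r - r) * chebU ?x (Suc n) = (1 / r - r) * chebT ?x n + ?x * ((1 / r - r) * chebU ?x n)"
    by (simp only: chebU.simps distrib_left mult.left_commute)
  also have "\<dots> = 1 / r ^ Suc n - r ^ Suc n"
    using assms by (simp only: Suc) (simp add: field_simps)
  finally show "(1 / r - r) * chebU ?x (Suc n) = 1 / r ^ Suc n - r ^ Suc n" .
qed auto

lemma poly_chebT_chebU:
  shows "poly (chebT p n) x = chebT (poly p x) n" and "poly (chebU p n) x = chebU (poly p x) n"
  by (induction n) auto

lemma pderiv_chebT_chebU:
  fixes p :: "'a::idom poly"
  shows "pderiv (chebT p n) = of_nat n * chebU p n * pderiv p"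
    and "(p * p - 1) * pderiv (chebU p n) = (of_nat n * chebT p n - p * chebU p n) * pderiv p"
proof (induction n)
  case (Suc n)
  have "pderiv (chebT p (Suc n)) = p * pderiv (chebT p n) + pderiv p * chebT p n
      + (p * p - 1) * pderiv (chebU p n) + 2 * p * pderiv p * chebU p n"
    by (simp add: pderiv_add pderiv_mult pderiv_diff algebra_simps)
  then show "pderiv (chebT p (Suc n)) = of_nat (Suc n) * chebU p (Suc n) * pderiv p"
    by (simp only: Suc) (simp add: algebra_simps)
  have "(p * p - 1) * pderiv (chebU p (Suc n))
      = (p * p - 1) * pderiv (chebT p n) + (p * p - 1) * pderiv p * chebU p n
        + p * ((p * p - 1) * pderiv (chebU p n))"
    by (simp add: pderiv_add pderiv_mult pderiv_diff algebra_simps)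
  then show "(p * p - 1) * pderiv (chebU p (Suc n))
      = (of_nat (Suc n) * chebT p (Suc n) - p * chebU p (Suc n)) * pderiv p"
    by (simp only: Suc) (simp add: algebra_simps)
qed auto

lemma degree_chebT_chebU:
  fixes p :: "'a::comm_ring_1 poly"
  assumes "degree p \<le> 1"
  shows "degree (chebT p n) \<le> n" and "degree (chebU p n) \<le> n - 1"
proof (induction n)
  case (Suc n)
  have degree_pT: "degree (p * chebT p n) \<le> Suc n"
    using degree_mult_le[of p "chebT p n"] assms Suc by linarith
  have "degree (p * p - 1) \<le> 2"
    using degree_mult_le[of p p] assms by (intro degree_diff_le) auto
  then have degree_ppU: "degree ((p * p - 1) * chebU p n) \<le> Suc n"
    using degree_mult_le[of "p * p - 1" "chebU p n"] Suc by (cases n) auto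
  have degree_pU: "degree (p * chebU p n) \<le> n"
    using degree_mult_le[of p "chebU p n"] assms Suc by (cases n) auto
  show "degree (chebT p (Suc n)) \<le> Suc n" and "degree (chebU p (Suc n)) \<le> Suc n - 1"
    using degree_pT degree_ppU degree_pU Suc by (auto intro: degree_add_le)
qed auto

definition chebyshev_rate :: "real \<Rightarrow> real" where
  "chebyshev_rate \<kappa> = (sqrt \<kappa> - 1) / (sqrt \<kappa> + 1)"

lemma chebyshev_rate_pos: "1 < \<kappa> \<Longrightarrow> 0 < chebyshev_rate \<kappa>"
  by (simp add: chebyshev_rate_def add_pos_pos)

lemma chebyshev_rate_nonneg: "1 \<le> \<kappa> \<Longrightarrow> 0 \<le> chebyshev_rate \<kappa>"
  by (simp add: chebyshev_rate_def)

lemma chebyshev_rate_joukowski: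
  assumes "1 < \<kappa>"
  defines "\<rho> \<equiv> chebyshev_rate \<kappa>"
  shows "(\<kappa> + 1) / (\<kappa> - 1) = (\<rho> + 1 / \<rho>) / 2" and "(\<kappa> - 1) * (1 / \<rho> - \<rho>) = 4 * sqrt \<kappa>"
proof -
  define s where "s = sqrt \<kappa>"
  have s_gt_1: "1 < s" and \<kappa>_eq: "\<kappa> = s * s" using assms(1) by (simp_all add: s_def)
  have "1 < s * s" using assms(1) \<kappa>_eq by simp
  then show "(\<kappa> + 1) / (\<kappa> - 1) = (\<rho> + 1 / \<rho>) / 2" "(\<kappa> - 1) * (1 / \<rho> - \<rho>) = 4 * sqrt \<kappa>"
    using s_gt_1 unfolding \<rho>_def chebyshev_rate_def s_def[symmetric] \<kappa>_eq
    by (simp_all add: divide_simps) (simp_all add: algebra_simps)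
qed

text \<open>The argument decreases from 1 to -1 on \<open>[a, b]\<close>, so that it exceeds 1 at the point 0.\<close>
definition interval_chebT :: "real \<Rightarrow> real \<Rightarrow> nat \<Rightarrow> real poly" where
  "interval_chebT a b n = chebT [:(b + a) / (b - a), - 2 / (b - a):] n"

lemma degree_interval_chebT: "degree (interval_chebT a b n) \<le> n"
  unfolding interval_chebT_def by (rule degree_chebT_chebU) simp

lemma interval_chebT_coeff:
  shows "coeff (interval_chebT a b n) 0 = chebT ((b + a) / (b - a)) n"
    and "coeff (interval_chebT a b n) 1 = - 2 / (b - a) * real n * chebU ((b + a) / (b - a)) n"
proof -
  have "coeff (interval_chebT a b n) 1 = poly (pderiv (interval_chebT a b n)) 0"
    by (simp add: poly_0_coeff_0 coeff_pderiv)
  then show "coeff (interval_chebT a b n) 1 = - 2 / (b - a) * real n * chebU ((b + a) / (b - a)) n"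
    by (simp add: interval_chebT_def pderiv_chebT_chebU poly_chebT_chebU pderiv_pCons)
qed (simp add: interval_chebT_def poly_chebT_chebU flip: poly_0_coeff_0)

lemma interval_chebT_double:
  assumes "a < b"
  obtains p q where "1 + interval_chebT a b (2 * n) = Polynomial.smult 2 (p * p)"
    and "1 - interval_chebT a b (2 * n)
      = Polynomial.smult (8 / (b - a)\<^sup>2) (q * q * ([:-a, 1:] * [:b, -1:]))"
proof
  define l where "l = [:(b + a) / (b - a), - 2 / (b - a):]"
  have P_eq: "interval_chebT a b (2 * n) = chebT l (2 * n)" by (simp add: interval_chebT_def l_def)
  show "1 + interval_chebT a b (2 * n) = Polynomial.smult 2 (chebT l n * chebT l n)"
  proof (rule poly_ext)
    fix x
    show "poly (1 + interval_chebT a b (2 * n)) x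
        = poly (Polynomial.smult 2 (chebT l n * chebT l n)) x"
      using chebT_double(1)[of "poly l x" n] by (simp add: P_eq poly_chebT_chebU)
  qed
  show "1 - interval_chebT a b (2 * n)
      = Polynomial.smult (8 / (b - a)\<^sup>2) (chebU l n * chebU l n * ([:-a, 1:] * [:b, -1:]))"
    (is "_ = ?R")
  proof (rule poly_ext)
    fix x
    have "1 - poly l x * poly l x = 4 / (b - a)\<^sup>2 * ((x - a) * (b - x))"
      unfolding l_def using assms
      by (simp add: divide_simps power2_eq_square) (simp add: algebra_simps)
    then have "poly (1 - interval_chebT a b (2 * n)) x
        = 2 * (4 / (b - a)\<^sup>2 * ((x - a) * (b - x))) * (chebU (poly l x) n * chebU (poly l x) n)"
      using chebT_double(2)[of "poly l x" n] by (simp add: P_eq poly_chebT_chebU)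
    also have "\<dots> = poly ?R x" by (simp add: poly_chebT_chebU algebra_simps add_divide_distrib)
    finally show "poly (1 - interval_chebT a b (2 * n)) x = poly ?R x" .
  qed
qed

context
  fixes a b \<rho> :: real
  assumes ab: "0 < a" "a < b"
  defines "\<rho> \<equiv> chebyshev_rate (b / a)"
begin

lemma interval_chebT_rate:
  shows "0 < \<rho>" and "(b + a) / (b - a) = (\<rho> + 1 / \<rho>) / 2"
    and "(b - a) * (1 / \<rho> - \<rho>) = 4 * sqrt (b / a) * a"
proof -
  have ratio: "1 < b / a" using ab by simp
  show "0 < \<rho>" unfolding \<rho>_def using ratio by (rule chebyshev_rate_pos)
  have "(b + a) / (b - a) = (b / a + 1) / (b / a - 1)" using ab by (simp add: divide_simps)
  then show "(b + a) / (b - a) = (\<rho> + 1 / \<rho>) / 2"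
    using chebyshev_rate_joukowski(1)[OF ratio] by (simp add: \<rho>_def)
  have "(b - a) * (1 / \<rho> - \<rho>) = a * ((b / a - 1) * (1 / \<rho> - \<rho>))"
    using ab by (simp add: field_simps)
  then show "(b - a) * (1 / \<rho> - \<rho>) = 4 * sqrt (b / a) * a"
    using chebyshev_rate_joukowski(2)[OF ratio] by (simp add: \<rho>_def)
qed

lemma interval_chebT_at_0_closed_form:
  "coeff (interval_chebT a b n) 0 = (\<rho> ^ n + 1 / \<rho> ^ n) / 2"
  using chebT_chebU_closed_form(1)[of \<rho> n] interval_chebT_rate(1)
  by (simp add: interval_chebT_coeff interval_chebT_rate(2))

lemma interval_chebT_at_0_ge: "1 \<le> 2 * \<rho> ^ n * coeff (interval_chebT a b n) 0"
  unfolding interval_chebT_at_0_closed_form using interval_chebT_rate(1) by (simp add: field_simps)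

lemma interval_chebT_at_0_pos: "0 < coeff (interval_chebT a b n) 0"
  using chebT_ge_1[of "(b + a) / (b - a)" n] ab by (simp add: interval_chebT_coeff)

lemma interval_chebT_slope_at_0:
  shows "0 \<le> - coeff (interval_chebT a b n) 1"
    and "- coeff (interval_chebT a b n) 1
      \<le> real n * sqrt (b / a) / b * coeff (interval_chebT a b n) 0"
proof -
  define U where "U = chebU ((b + a) / (b - a)) n"
  define s where "s = sqrt (b / a)"
  let ?N = "coeff (interval_chebT a b n) 0"
  have slope: "- coeff (interval_chebT a b n) 1 = real n * (2 / (b - a) * U)"
    unfolding interval_chebT_coeff by (simp add: U_def)
  have "1 \<le> (b + a) / (b - a)" using ab by simp
  then show "0 \<le> - coeff (interval_chebT a b n) 1"
    unfolding slope U_def using ab by (simp add: chebU_nonneg)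
  have s_pos: "0 < s" and b_eq: "b = a * (s * s)" using ab by (simp_all add: s_def)
  have "(1 / \<rho> - \<rho>) * U \<le> 2 * ?N"
    using chebT_chebU_closed_form(2)[of \<rho> n] interval_chebT_rate(1)
    unfolding interval_chebT_at_0_closed_form U_def interval_chebT_rate(2) by simp
  then have "4 * s * a * U \<le> (b - a) * (2 * ?N)"
    using ab unfolding s_def interval_chebT_rate(3)[symmetric] mult.assoc[of "b - a"]
    by (intro mult_left_mono) auto
  then have "2 * s * a * U \<le> (b - a) * ?N" by (simp add: algebra_simps)
  then have "2 / (b - a) * U \<le> ?N / (s * a)"
    using ab s_pos by (simp add: divide_simps mult_ac)
  also have "\<dots> = s / b * ?N" using ab s_pos by (simp add: b_eq)
  finally have "real n * (2 / (b - a) * U) \<le> real n * (s / b * ?N)"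
    by (intro mult_left_mono) auto
  then show "- coeff (interval_chebT a b n) 1 \<le> real n * sqrt (b / a) / b * ?N"
    unfolding slope by (simp add: s_def mult_ac)
qed

end

section \<open>Moment sequences on an interval\<close>

definition moment_functional :: "(nat \<Rightarrow> real) \<Rightarrow> real poly \<Rightarrow> real" where
  "moment_functional m p = (\<Sum>i\<le>degree p. coeff p i * m i)"

lemma moment_functional_upto:
  assumes "degree p \<le> d"
  shows "moment_functional m p = (\<Sum>i\<le>d. coeff p i * m i)"
  unfolding moment_functional_def using assms
  by (intro sum.mono_neutral_left) (auto simp: coeff_eq_0)

lemma moment_functional_add:
  "moment_functional m (p + q) = moment_functional m p + moment_functional m q"
proof -
  let ?d = "max (degree p) (degree q)"
  have "degree (p + q) \<le> ?d" by (rule degree_add_le_max)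
  then show ?thesis
    by (simp add: moment_functional_upto[of _ ?d] algebra_simps sum.distrib)
qed

lemma moment_functional_smult:
  "moment_functional m (Polynomial.smult c p) = c * moment_functional m p"
  by (simp add: moment_functional_upto[of _ "degree p"] sum_distrib_left mult.assoc)

lemma moment_functional_diff:
  "moment_functional m (p - q) = moment_functional m p - moment_functional m q"
  using moment_functional_add[of m p "Polynomial.smult (-1) q"] moment_functional_smult[of m "-1" q]
  by simp

lemma moment_functional_1: "moment_functional m 1 = m 0"
  by (simp add: moment_functional_def)

lemma moment_functional_monom: "moment_functional m (monom c i) = c * m i"
proof -
  have "(\<Sum>j\<le>i. coeff (monom c i) j * m j) = (\<Sum>j\<in>{i}. c * m j)"
    by (rule sum.mono_neutral_cong_right) auto
  then show ?thesis by (simp add: moment_functional_upto[OF degree_monom_le])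
qed

lemma moment_functional_sum: "moment_functional m (sum f S) = (\<Sum>i\<in>S. moment_functional m (f i))"
  by (induction S rule: infinite_finite_induct)
    (auto simp: moment_functional_add moment_functional_def[of m 0])

lemma moment_functional_mult:
  "moment_functional m (p * q)
    = (\<Sum>i\<le>degree p. \<Sum>j\<le>degree q. coeff p i * coeff q j * m (i + j))"
proof -
  have "p * q = (\<Sum>i\<le>degree p. \<Sum>j\<le>degree q. monom (coeff p i * coeff q j) (i + j))"
    using arg_cong2[of _ _ _ _ "(*)", OF poly_as_sum_of_monoms[of p] poly_as_sum_of_monoms[of q]]
    by (simp add: sum_product mult_monom)
  then show ?thesis by (simp add: moment_functional_sum moment_functional_monom)
qed

lemma moment_functional_pCons_0:
  "moment_functional m (pCons 0 p) = moment_functional (\<lambda>i. m (Suc i)) p"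
proof -
  have "moment_functional m (pCons 0 p) = (\<Sum>i\<le>Suc (degree p). coeff (pCons 0 p) i * m i)"
    by (rule moment_functional_upto) (rule degree_pCons_le)
  then show ?thesis
    by (simp add: sum.atMost_Suc_shift moment_functional_def del: sum.atMost_Suc)
qed

lemma moment_functional_combine:
  "moment_functional (\<lambda>i. u * m i + v * m' i) p
    = u * moment_functional m p + v * moment_functional m' p"
  by (simp add: moment_functional_def algebra_simps sum.distrib sum_distrib_left)

text \<open>
  Positivity on the quadratic module of \<open>[a, b]\<close>: it stands in for integration against a measure
  supported there and holds for \<open>w \<bullet> C\<^sup>i w\<close> without diagonalising C.
\<close>
definition moments_on :: "real \<Rightarrow> real \<Rightarrow> (nat \<Rightarrow> real) \<Rightarrow> bool" where
  "moments_on a b m \<longleftrightarrow> (\<forall>q. 0 \<le> moment_functional m (q * q)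
      \<and> 0 \<le> moment_functional m (q * q * [:-a, 1:]) \<and> 0 \<le> moment_functional m (q * q * [:b, -1:]))"

lemma moments_onD:
  assumes "moments_on a b m"
  shows "0 \<le> moment_functional m (q * q)"
    and "0 \<le> moment_functional m (q * q * [:-a, 1:])"
    and "0 \<le> moment_functional m (q * q * [:b, -1:])"
  using assms by (auto simp: moments_on_def)

lemma moments_on_0_nonneg: "moments_on a b m \<Longrightarrow> 0 \<le> m 0"
  using moments_onD(1)[of a b m 1] by (simp add: moment_functional_1)

lemma moments_on_mono:
  assumes "moments_on a b m" and "b \<le> b'"
  shows "moments_on a b' m"
proof -
  have "0 \<le> moment_functional m (q * q * [:b', -1:])" for q
  proof -
    have "q * q * [:b', -1:] = q * q * [:b, -1:] + Polynomial.smult (b' - b) (q * q)"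
      by (rule poly_ext) (simp add: algebra_simps)
    then show ?thesis
      using assms moments_onD[OF assms(1), of q]
      by (simp only: moment_functional_add moment_functional_smult) simp
  qed
  then show ?thesis using assms(1) by (simp add: moments_on_def)
qed

lemma moments_on_combine:
  assumes "moments_on a b m" "moments_on a b m'" "0 \<le> u" "0 \<le> v"
  shows "moments_on a b (\<lambda>i. u * m i + v * m' i)"
  unfolding moments_on_def moment_functional_combine
  by (intro allI conjI add_nonneg_nonneg mult_nonneg_nonneg
      moments_onD[OF assms(1)] moments_onD[OF assms(2)] assms(3,4))

lemma moments_on_interval_weight:
  assumes moments: "moments_on a b m" and "a < b"
  shows "0 \<le> moment_functional m (q * q * ([:-a, 1:] * [:b, -1:]))"
proof -
  have "Polynomial.smult (b - a) (q * q * ([:-a, 1:] * [:b, -1:]))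
      = (q * [:-a, 1:]) * (q * [:-a, 1:]) * [:b, -1:] + (q * [:b, -1:]) * (q * [:b, -1:]) * [:-a, 1:]"
    by (rule poly_ext) (simp add: algebra_simps)
  then have "0 \<le> (b - a) * moment_functional m (q * q * ([:-a, 1:] * [:b, -1:]))"
    using moments_onD(3)[OF moments, of "q * [:-a, 1:]"]
      moments_onD(2)[OF moments, of "q * [:b, -1:]"]
    by (simp only: moment_functional_smult[symmetric] moment_functional_add)
  then show ?thesis using \<open>a < b\<close> by (simp add: zero_le_mult_iff)
qed

lemma moments_on_Suc:
  assumes moments: "moments_on a b m" and ab: "0 \<le> a" "a < b"
  shows "moments_on a b (\<lambda>i. m (Suc i))"
  unfolding moments_on_def moment_functional_pCons_0[symmetric]
proof (intro allI conjI)
  fix q :: "real poly"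
  have "pCons 0 (q * q) = q * q * [:-a, 1:] + Polynomial.smult a (q * q)"
    and "pCons 0 (q * q * [:-a, 1:])
      = (q * [:-a, 1:]) * (q * [:-a, 1:]) + Polynomial.smult a (q * q * [:-a, 1:])"
    and "pCons 0 (q * q * [:b, -1:])
      = q * q * ([:-a, 1:] * [:b, -1:]) + Polynomial.smult a (q * q * [:b, -1:])"
    by (auto intro!: poly_ext simp: algebra_simps)
  then show "0 \<le> moment_functional m (pCons 0 (q * q))"
    and "0 \<le> moment_functional m (pCons 0 (q * q * [:-a, 1:]))"
    and "0 \<le> moment_functional m (pCons 0 (q * q * [:b, -1:]))"
    using moments_onD[OF moments, of q] moments_onD(1)[OF moments, of "q * [:-a, 1:]"]
      moments_on_interval_weight[OF moments ab(2), of q] ab(1)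
    by (simp_all only: moment_functional_add moment_functional_smult
        add_nonneg_nonneg mult_nonneg_nonneg)
qed

lemma moment_functional_interval_chebT_le:
  assumes moments: "moments_on a b m" and "a < b"
  shows "\<bar>moment_functional m (interval_chebT a b (2 * k))\<bar> \<le> m 0"
proof -
  let ?P = "interval_chebT a b (2 * k)"
  obtain p q where one_plus_minus: "1 + ?P = Polynomial.smult 2 (p * p)"
    "1 - ?P = Polynomial.smult (8 / (b - a)\<^sup>2) (q * q * ([:-a, 1:] * [:b, -1:]))"
    using interval_chebT_double[OF \<open>a < b\<close>] .
  have "0 \<le> moment_functional m (1 + ?P)" and "0 \<le> moment_functional m (1 - ?P)"
    unfolding one_plus_minus moment_functional_smult
    using moments_onD(1)[OF moments] moments_on_interval_weight[OF moments \<open>a < b\<close>]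
    by (auto intro!: mult_nonneg_nonneg)
  then show ?thesis
    by (simp add: moment_functional_add moment_functional_diff moment_functional_1 abs_le_iff)
qed

lemma moment_functional_agree_except_0:
  assumes "degree p \<le> d" and "\<And>i. 0 < i \<Longrightarrow> i \<le> d \<Longrightarrow> coeff p i = 0 \<or> m i = m' i"
  shows "moment_functional m p - moment_functional m' p = coeff p 0 * (m 0 - m' 0)"
proof -
  have "moment_functional m p - moment_functional m' p = (\<Sum>i\<le>d. coeff p i * (m i - m' i))"
    by (simp add: moment_functional_upto[OF assms(1)] sum_subtractf right_diff_distrib)
  also have "\<dots> = (\<Sum>i\<in>{0}. coeff p i * (m i - m' i))"
    using assms(2) by (intro sum.mono_neutral_right) auto
  finally show ?thesis by simp
qed

text \<open>
  The intended \<open>m i\<close> is the integral of \<open>t\<^sup>i\<^sup>-\<^sup>2\<close>, so that agreement from index 2 on is quadrature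
  exactness up to degree \<open>2k - 1\<close>. The product of the weight \<open>N + D t\<close> and the Chebyshev polynomial
  has no linear term, where the sequences may differ.
\<close>
lemma moment_0_gap_weighted:
  assumes moments: "moments_on a b m" "moments_on a b m'" and ab: "0 < a" "a < b"
    and agree: "\<And>i. 2 \<le> i \<Longrightarrow> i \<le> 2 * k + 1 \<Longrightarrow> m i = m' i"
  defines "N \<equiv> coeff (interval_chebT a b (2 * k)) 0" and "D \<equiv> - coeff (interval_chebT a b (2 * k)) 1"
  shows "N * N * (m 0 - m' 0) \<le> (N * m 0 + D * m 1) + (N * m' 0 + D * m' 1)"
proof -
  let ?P = "interval_chebT a b (2 * k)"
  have ND_signs: "0 < N" "0 \<le> D"
    unfolding N_def D_def
    by (rule interval_chebT_at_0_pos[OF ab] interval_chebT_slope_at_0(1)[OF ab])+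
  define f where "f = Polynomial.smult N ?P + pCons 0 (Polynomial.smult D ?P)"
  have bound: "\<bar>moment_functional \<mu> f\<bar> \<le> N * \<mu> 0 + D * \<mu> 1"
    if moments_mu: "moments_on a b \<mu>" for \<mu>
  proof -
    have "moments_on a b (\<lambda>i. N * \<mu> i + D * \<mu> (Suc i))"
      using moments_mu ab ND_signs by (intro moments_on_combine moments_on_Suc) auto
    from moment_functional_interval_chebT_le[OF this ab(2), of k] show ?thesis
      by (simp add: moment_functional_combine f_def moment_functional_add moment_functional_smult
          moment_functional_pCons_0)
  qed
  have "degree f \<le> 2 * k + 1"
    unfolding f_def using degree_interval_chebT[of a b "2 * k"]
    by (intro degree_add_le order.trans[OF degree_pCons_le])
      (auto intro: order.trans[OF degree_smult_le])
  moreover have "coeff f 0 = N * N" and "coeff f 1 = 0"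
    by (simp_all add: f_def N_def D_def)
  moreover from this have "coeff f i = 0 \<or> m i = m' i" if "0 < i" "i \<le> 2 * k + 1" for i
    using that agree[of i] by (cases "i = 1") auto
  ultimately have "moment_functional m f - moment_functional m' f = N * N * (m 0 - m' 0)"
    using moment_functional_agree_except_0[of f "2 * k + 1" m m'] by simp
  then show ?thesis using bound[OF moments(1)] bound[OF moments(2)] by linarith
qed

lemma quadrature_error_nondegenerate:
  assumes moments: "moments_on a b m" "moments_on a b m'" and ab: "0 < a" "a < b"
    and agree: "\<And>i. 2 \<le> i \<Longrightarrow> i \<le> 2 * k + 1 \<Longrightarrow> m i = m' i"
    and first: "m' 1 \<le> m 1"
  shows "m 0 - m' 0
    \<le> 4 * chebyshev_rate (b / a) ^ (2 * k) * (m 0 + 2 * real k * sqrt (b / a) / b * m 1)"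
proof -
  define \<rho> where "\<rho> = chebyshev_rate (b / a) ^ (2 * k)"
  define K where "K = real (2 * k) * sqrt (b / a) / b"
  define N where "N = coeff (interval_chebT a b (2 * k)) 0"
  define D where "D = - coeff (interval_chebT a b (2 * k)) 1"
  have N_pos: "0 < N" and rate_N: "1 \<le> 2 * \<rho> * N" and D_bounds: "0 \<le> D" "D \<le> K * N"
    unfolding \<rho>_def K_def N_def D_def
    by (rule interval_chebT_at_0_pos[OF ab] interval_chebT_at_0_ge[OF ab]
        interval_chebT_slope_at_0[OF ab])+
  have rate_nonneg: "0 \<le> \<rho>"
    using ab unfolding \<rho>_def by (intro zero_le_power chebyshev_rate_nonneg) simp
  have K_nonneg: "0 \<le> K" using ab by (simp add: K_def)
  have nonneg: "0 \<le> m 0" "0 \<le> m 1"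
    using moments_on_0_nonneg[OF moments(1)] moments_on_0_nonneg[OF moments_on_Suc[OF moments(1)]] ab
    by auto
  then have bound_nonneg: "0 \<le> m 0 + K * m 1" using K_nonneg by simp
  have "m 0 - m' 0 \<le> 4 * \<rho> * (m 0 + K * m 1)"
  proof (cases "m 0 \<le> m' 0")
    case True
    moreover have "0 \<le> 4 * \<rho> * (m 0 + K * m 1)" using rate_nonneg bound_nonneg by simp
    ultimately show ?thesis by linarith
  next
    case False
    have "N * N * (m 0 - m' 0) \<le> (N * m 0 + D * m 1) + (N * m' 0 + D * m' 1)"
      unfolding N_def D_def by (rule moment_0_gap_weighted[OF moments ab agree])
    also have "\<dots> \<le> (N * m 0 + D * m 1) + (N * m 0 + D * m 1)"
      using False N_pos D_bounds first by (intro add_left_mono add_mono mult_left_mono) auto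
    also have "\<dots> \<le> (N * m 0 + K * N * m 1) + (N * m 0 + K * N * m 1)"
      using D_bounds nonneg by (intro add_mono mult_right_mono) auto
    finally have "N * (N * (m 0 - m' 0)) \<le> N * (2 * (m 0 + K * m 1))" by (simp add: algebra_simps)
    then have "N * (m 0 - m' 0) \<le> 2 * (m 0 + K * m 1)" using N_pos by simp
    then have "2 * \<rho> * (N * (m 0 - m' 0)) \<le> 2 * \<rho> * (2 * (m 0 + K * m 1))"
      using rate_nonneg by (intro mult_left_mono) auto
    moreover have "1 * (m 0 - m' 0) \<le> 2 * \<rho> * N * (m 0 - m' 0)"
      using rate_N False by (intro mult_right_mono) auto
    ultimately show ?thesis by (simp add: algebra_simps)
  qed
  then show ?thesis by (simp add: \<rho>_def K_def)
qed

text \<open>The case \<open>a = b\<close> is the limit of enlarged intervals \<open>[a, b']\<close>.\<close>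
lemma quadrature_error:
  assumes moments: "moments_on a b m" "moments_on a b m'" and ab: "0 < a" "a \<le> b"
    and agree: "\<And>i. 2 \<le> i \<Longrightarrow> i \<le> 2 * k + 1 \<Longrightarrow> m i = m' i"
    and first: "m' 1 \<le> m 1"
  shows "m 0 - m' 0
    \<le> 4 * chebyshev_rate (b / a) ^ (2 * k) * (m 0 + 2 * real k * sqrt (b / a) / b * m 1)"
proof (rule tendsto_lowerbound)
  let ?E = "\<lambda>b'. 4 * chebyshev_rate (b' / a) ^ (2 * k)
    * (m 0 + 2 * real k * sqrt (b' / a) / b' * m 1)"
  have "0 \<le> sqrt (b / a)" using ab by simp
  then have "sqrt (b / a) + 1 \<noteq> 0" by linarith
  then show "(?E \<longlongrightarrow> ?E b) (at_right b)"
    unfolding chebyshev_rate_def using ab by (intro tendsto_intros) auto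
  show "eventually (\<lambda>b'. m 0 - m' 0 \<le> ?E b') (at_right b)"
    using quadrature_error_nondegenerate[OF moments(1,2)[THEN moments_on_mono]] first ab agree
    by (intro eventually_at_rightI[of b "b + 1"]) auto
qed simp

section \<open>Quadratic forms of symmetric matrices\<close>

lemma scalar_prod_self_nonneg: "0 \<le> (v :: real vec) \<bullet> v"
  using conjugate_square_ge_0_vec[of v] by simp

lemma scalar_prod_self_eq_0_iff: "(v :: real vec) \<in> carrier_vec n \<Longrightarrow> v \<bullet> v = 0 \<longleftrightarrow> v = 0\<^sub>v n"
  using conjugate_square_eq_0_vec[of v n] by simp

lemma scalar_prod_self_pos: "(v :: real vec) \<in> carrier_vec n \<Longrightarrow> v \<noteq> 0\<^sub>v n \<Longrightarrow> 0 < v \<bullet> v"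
  using conjugate_square_greater_0_vec[of v n] by simp

lemma vnorm_sq: "vnorm v * vnorm v = v \<bullet> v"
  by (simp add: vnorm_def scalar_prod_self_nonneg)

lemma vnorm_pos: "v \<in> carrier_vec n \<Longrightarrow> v \<noteq> 0\<^sub>v n \<Longrightarrow> 0 < vnorm v"
  by (simp add: vnorm_def scalar_prod_self_pos)

lemma vnorm_smult: "vnorm (c \<cdot>\<^sub>v v) = \<bar>c\<bar> * vnorm v"
  by (simp add: vnorm_def real_sqrt_mult flip: mult.assoc)

lemma vnorm_uminus: "vnorm (- v) = vnorm v"
  by (simp add: vnorm_def)

lemma mult_mat_vec_uminus:
  fixes C :: "'a::ring mat"
  assumes "v \<in> carrier_vec (dim_col C)"
  shows "C *\<^sub>v (- v) = - (C *\<^sub>v v)"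
  using assms by (intro eq_vecI) auto

lemma mult_mat_vec_zero: "C \<in> carrier_mat m n \<Longrightarrow> C *\<^sub>v 0\<^sub>v n = 0\<^sub>v m"
  by (intro eq_vecI) auto

lemma shift_mult_vec:
  fixes C :: "'a::comm_ring_1 mat"
  assumes "C \<in> carrier_mat n n" "v \<in> carrier_vec n"
  shows "(C + l \<cdot>\<^sub>m 1\<^sub>m n) *\<^sub>v v = C *\<^sub>v v + l \<cdot>\<^sub>v v"
  using assms by (intro eq_vecI) (auto simp: add_scalar_prod_distrib[of _ n] scalar_prod_left_unit)

lemma pow_mat_mult_vec_carrier:
  "C \<in> carrier_mat n n \<Longrightarrow> v \<in> carrier_vec n \<Longrightarrow> (C ^\<^sub>m i) *\<^sub>v v \<in> carrier_vec n"
  by (rule mult_mat_vec_carrier[OF pow_carrier_mat])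

lemma pow_mat_Suc_mult_vec:
  fixes C :: "'a::semiring_1 mat"
  assumes C_carrier: "C \<in> carrier_mat n n" and v_carrier: "v \<in> carrier_vec n"
  shows "(C ^\<^sub>m Suc i) *\<^sub>v v = C *\<^sub>v ((C ^\<^sub>m i) *\<^sub>v v)"
    and "(C ^\<^sub>m Suc i) *\<^sub>v v = (C ^\<^sub>m i) *\<^sub>v (C *\<^sub>v v)"
proof -
  have right: "(C ^\<^sub>m Suc i) *\<^sub>v u = (C ^\<^sub>m i) *\<^sub>v (C *\<^sub>v u)" if "u \<in> carrier_vec n" for i u
    using assoc_mult_mat_vec[OF pow_carrier_mat[OF C_carrier] C_carrier that] by simp
  show "(C ^\<^sub>m Suc i) *\<^sub>v v = (C ^\<^sub>m i) *\<^sub>v (C *\<^sub>v v)" using v_carrier by (rule right)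
  show "(C ^\<^sub>m Suc i) *\<^sub>v v = C *\<^sub>v ((C ^\<^sub>m i) *\<^sub>v v)"
    using v_carrier
  proof (induction i arbitrary: v)
    case (Suc i)
    then have "(C ^\<^sub>m Suc (Suc i)) *\<^sub>v v = (C ^\<^sub>m Suc i) *\<^sub>v (C *\<^sub>v v)" by (intro right)
    also have "\<dots> = C *\<^sub>v ((C ^\<^sub>m i) *\<^sub>v (C *\<^sub>v v))" using Suc.prems C_carrier by (intro Suc.IH) auto
    also have "\<dots> = C *\<^sub>v ((C ^\<^sub>m Suc i) *\<^sub>v v)" by (simp only: right[OF Suc.prems])
    finally show ?case .
  qed (use C_carrier in simp)
qed

lemma symmetric_mat_carrier: "symmetric_mat n C \<Longrightarrow> C \<in> carrier_mat n n"
  by (simp add: symmetric_mat_def)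

lemma symmetric_mat_one: "symmetric_mat n (1\<^sub>m n)"
  by (simp add: symmetric_mat_def)

lemma symmetric_mat_uminus: "symmetric_mat n C \<Longrightarrow> symmetric_mat n (- C)"
  by (simp add: symmetric_mat_def transpose_uminus)

lemma symmetric_mat_shift: "symmetric_mat n C \<Longrightarrow> symmetric_mat n (C + l \<cdot>\<^sub>m 1\<^sub>m n)"
  unfolding symmetric_mat_def
  by (auto intro!: eq_matI) (metis index_transpose_mat(1) carrier_matD)

lemma symmetric_mat_scalar_prod:
  assumes "symmetric_mat n C" "u \<in> carrier_vec n" "v \<in> carrier_vec n"
  shows "(C *\<^sub>v u) \<bullet> v = u \<bullet> (C *\<^sub>v v)"
  using transpose_vec_mult_scalar[of C n n v u] assms by (simp add: symmetric_mat_def)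

lemma symmetric_mat_pow_scalar_prod:
  assumes C_sym: "symmetric_mat n C" and uv_carrier: "u \<in> carrier_vec n" "v \<in> carrier_vec n"
  shows "((C ^\<^sub>m i) *\<^sub>v u) \<bullet> ((C ^\<^sub>m j) *\<^sub>v v) = u \<bullet> ((C ^\<^sub>m (i + j)) *\<^sub>v v)"
  using uv_carrier(1)
proof (induction i arbitrary: u)
  case (Suc i)
  note C_carrier = symmetric_mat_carrier[OF C_sym]
  have pow: "(C ^\<^sub>m (i + j)) *\<^sub>v v \<in> carrier_vec n"
    by (rule pow_mat_mult_vec_carrier[OF C_carrier uv_carrier(2)])
  have "((C ^\<^sub>m Suc i) *\<^sub>v u) \<bullet> ((C ^\<^sub>m j) *\<^sub>v v) = (C *\<^sub>v u) \<bullet> ((C ^\<^sub>m (i + j)) *\<^sub>v v)"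
    using Suc C_carrier by (simp only: pow_mat_Suc_mult_vec(2)) simp
  also have "\<dots> = u \<bullet> (C *\<^sub>v ((C ^\<^sub>m (i + j)) *\<^sub>v v))"
    by (rule symmetric_mat_scalar_prod[OF C_sym Suc.prems pow])
  finally show ?case by (simp only: add_Suc pow_mat_Suc_mult_vec(1)[OF C_carrier uv_carrier(2)])
qed (use symmetric_mat_carrier[OF C_sym] in simp)

lemma quadratic_form_add_smult:
  assumes C_sym: "symmetric_mat n C" and uv_carrier: "u \<in> carrier_vec n" "v \<in> carrier_vec n"
  shows "(u + t \<cdot>\<^sub>v v) \<bullet> (C *\<^sub>v (u + t \<cdot>\<^sub>v v))
    = u \<bullet> (C *\<^sub>v u) + 2 * t * (u \<bullet> (C *\<^sub>v v)) + t * t * (v \<bullet> (C *\<^sub>v v))"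
proof -
  have C_carrier: "C \<in> carrier_mat n n" using C_sym by (rule symmetric_mat_carrier)
  have "v \<bullet> (C *\<^sub>v u) = u \<bullet> (C *\<^sub>v v)"
    using symmetric_mat_scalar_prod[OF C_sym uv_carrier(2,1)] comm_scalar_prod[of "C *\<^sub>v v" n u]
      C_carrier uv_carrier
    by simp
  then show ?thesis using C_carrier uv_carrier
    by (simp add: mult_add_distrib_mat_vec[of C n n] mult_mat_vec[of C n n]
        add_scalar_prod_distrib[of _ n] scalar_prod_add_distrib[of _ n] algebra_simps)
qed

lemma nonneg_quadratic_discriminant_le:
  fixes \<alpha> \<beta> \<gamma> :: real
  assumes "\<alpha> \<ge> 0" and nonneg: "\<And>t. \<gamma> + 2 * t * \<beta> + t * t * \<alpha> \<ge> 0"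
  shows "\<beta> * \<beta> \<le> \<gamma> * \<alpha>"
proof (cases "\<alpha> = 0")
  case True
  have "\<beta> = 0"
  proof (rule ccontr)
    assume "\<beta> \<noteq> 0"
    then show False using nonneg[of "- (\<gamma> + 1) / (2 * \<beta>)"] True by (simp add: field_simps)
  qed
  then show ?thesis using True by simp
next
  case False
  then have "\<alpha> > 0" using assms(1) by simp
  then show ?thesis using nonneg[of "- \<beta> / \<alpha>"] by (simp add: field_simps)
qed

lemma psd_Cauchy_Schwarz:
  assumes C_psd: "symmetric_mat n C" "psd_mat n C"
    and uv_carrier: "u \<in> carrier_vec n" "v \<in> carrier_vec n"
  shows "(u \<bullet> (C *\<^sub>v v)) * (u \<bullet> (C *\<^sub>v v)) \<le> (u \<bullet> (C *\<^sub>v u)) * (v \<bullet> (C *\<^sub>v v))"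
proof (rule nonneg_quadratic_discriminant_le)
  show "v \<bullet> (C *\<^sub>v v) \<ge> 0" using C_psd(2) uv_carrier by (auto simp: psd_mat_def)
  show "u \<bullet> (C *\<^sub>v u) + 2 * t * (u \<bullet> (C *\<^sub>v v)) + t * t * (v \<bullet> (C *\<^sub>v v)) \<ge> 0" for t
    using C_psd(2) uv_carrier unfolding quadratic_form_add_smult[OF C_psd(1) uv_carrier, symmetric]
    by (auto simp: psd_mat_def)
qed

lemma scalar_prod_le_vnorm:
  assumes uv_carrier: "u \<in> carrier_vec n" "v \<in> carrier_vec n"
  shows "u \<bullet> v \<le> vnorm u * vnorm v"
proof -
  have "(u \<bullet> v)\<^sup>2 \<le> (u \<bullet> u) * (v \<bullet> v)"
    using psd_Cauchy_Schwarz[OF symmetric_mat_one _ uv_carrier] uv_carrier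
    by (simp add: psd_mat_def scalar_prod_self_nonneg power2_eq_square)
  then show ?thesis
    unfolding vnorm_def real_sqrt_mult[symmetric] by (rule real_le_rsqrt)
qed

lemma quadratic_form_bounded:
  fixes C :: "real mat"
  assumes C_carrier: "C \<in> carrier_mat n n"
  obtains K where "K > 0" "\<And>v. v \<in> carrier_vec n \<Longrightarrow> \<bar>v \<bullet> (C *\<^sub>v v)\<bar> \<le> K * (v \<bullet> v)"
proof
  let ?K = "1 + (\<Sum>i<n. \<Sum>j<n. \<bar>C $$ (i, j)\<bar>)"
  show "?K > 0" by (simp add: add_pos_nonneg sum_nonneg)
  fix v :: "real vec" assume v_carrier: "v \<in> carrier_vec n"
  have entry: "\<bar>v $ i\<bar> * \<bar>v $ j\<bar> \<le> v \<bullet> v" if "i < n" "j < n" for i j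
  proof -
    have "v $ l * v $ l \<le> v \<bullet> v" if "l < n" for l
      unfolding scalar_prod_def using v_carrier that
      by (intro member_le_sum[of l _ "\<lambda>l. v $ l * v $ l"]) auto
    from this[OF \<open>i < n\<close>] this[OF \<open>j < n\<close>] show ?thesis
      using sum_squares_bound[of "\<bar>v $ i\<bar>" "\<bar>v $ j\<bar>"] by (simp add: power2_eq_square)
  qed
  have "\<bar>v \<bullet> (C *\<^sub>v v)\<bar> = \<bar>\<Sum>i<n. \<Sum>j<n. C $$ (i, j) * (v $ i * v $ j)\<bar>"
    using C_carrier v_carrier
    by (simp add: scalar_prod_def atLeast0LessThan sum_distrib_left mult_ac)
  also have "\<dots> \<le> (\<Sum>i<n. \<Sum>j<n. \<bar>C $$ (i, j)\<bar> * (\<bar>v $ i\<bar> * \<bar>v $ j\<bar>))"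
    by (intro order.trans[OF sum_abs] sum_mono) (simp add: abs_mult)
  also have "\<dots> \<le> (\<Sum>i<n. \<Sum>j<n. \<bar>C $$ (i, j)\<bar> * (v \<bullet> v))"
    using entry by (intro sum_mono mult_left_mono) auto
  also have "\<dots> \<le> ?K * (v \<bullet> v)"
    using scalar_prod_self_nonneg[of v] by (simp add: sum_distrib_right distrib_right)
  finally show "\<bar>v \<bullet> (C *\<^sub>v v)\<bar> \<le> ?K * (v \<bullet> v)" .
qed

lemma mat_inv_inverse:
  assumes C_carrier: "C \<in> carrier_mat n n" and "det C \<noteq> 0"
  shows "mat_inv C \<in> carrier_mat n n" and "C * mat_inv C = 1\<^sub>m n" and "mat_inv C * C = 1\<^sub>m n"
proof -
  obtain D where "D \<in> carrier_mat n n" "C * D = 1\<^sub>m n" "D * C = 1\<^sub>m n"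
    using det_non_zero_imp_unit[OF assms, of "()"] by (auto simp: Units_def ring_mat_def)
  then have "\<exists>D. D \<in> carrier_mat (dim_col C) (dim_row C) \<and> inverts_mat C D \<and> inverts_mat D C"
    using C_carrier by (auto simp: inverts_mat_def)
  then have "mat_inv C \<in> carrier_mat (dim_col C) (dim_row C) \<and> inverts_mat C (mat_inv C)
      \<and> inverts_mat (mat_inv C) C"
    unfolding mat_inv_def by (rule someI_ex)
  then show "mat_inv C \<in> carrier_mat n n" "C * mat_inv C = 1\<^sub>m n" "mat_inv C * C = 1\<^sub>m n"
    using C_carrier by (auto simp: inverts_mat_def)
qed

text \<open>Cauchy-Schwarz for the form of C, applied to v and to the solution w of C w = v.\<close>
lemma psd_invertible_imp_pd:
  assumes C_psd: "symmetric_mat n C" "psd_mat n C" and "det C \<noteq> 0"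
  obtains e where "e > 0" "\<And>v. v \<in> carrier_vec n \<Longrightarrow> e * (v \<bullet> v) \<le> v \<bullet> (C *\<^sub>v v)"
proof -
  note C_carrier = symmetric_mat_carrier[OF C_psd(1)]
  note inv = mat_inv_inverse[OF C_carrier \<open>det C \<noteq> 0\<close>]
  obtain K where K_bound: "K > 0" "\<And>v. v \<in> carrier_vec n \<Longrightarrow> \<bar>v \<bullet> (mat_inv C *\<^sub>v v)\<bar> \<le> K * (v \<bullet> v)"
    using quadratic_form_bounded[OF inv(1)] by blast
  show ?thesis
  proof
    show "1 / K > 0" using K_bound by simp
    fix v :: "real vec" assume v_carrier: "v \<in> carrier_vec n"
    let ?w = "mat_inv C *\<^sub>v v"
    have w_carrier: "?w \<in> carrier_vec n" using inv v_carrier by simp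
    have C_w: "C *\<^sub>v ?w = v"
      using assoc_mult_mat_vec[OF C_carrier inv(1) v_carrier] inv v_carrier by simp
    have form_nonneg: "v \<bullet> (C *\<^sub>v v) \<ge> 0" using C_psd v_carrier by (auto simp: psd_mat_def)
    have "(v \<bullet> v) * (v \<bullet> v) \<le> (v \<bullet> (C *\<^sub>v v)) * (?w \<bullet> v)"
      using psd_Cauchy_Schwarz[OF C_psd v_carrier w_carrier] by (simp add: C_w)
    also have "\<dots> \<le> (v \<bullet> (C *\<^sub>v v)) * (K * (v \<bullet> v))"
      using K_bound(2)[OF v_carrier] comm_scalar_prod[OF v_carrier w_carrier] form_nonneg
      by (intro mult_left_mono) auto
    finally have "(v \<bullet> v) * (v \<bullet> v) \<le> (K * (v \<bullet> (C *\<^sub>v v))) * (v \<bullet> v)"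
      by (simp add: mult_ac)
    then have "v \<bullet> v \<le> K * (v \<bullet> (C *\<^sub>v v))"
      using scalar_prod_self_nonneg[of v] K_bound(1) form_nonneg
      by (cases "v \<bullet> v = 0") (auto simp: mult_le_cancel_right)
    then show "1 / K * (v \<bullet> v) \<le> v \<bullet> (C *\<^sub>v v)" using K_bound by (simp add: field_simps)
  qed
qed

lemma greatest_rayleigh_lower_bound:
  fixes A :: "real mat"
  assumes A_carrier: "A \<in> carrier_mat n n" and n_pos: "n > 0"
  obtains \<mu> where "\<And>v. v \<in> carrier_vec n \<Longrightarrow> \<mu> * (v \<bullet> v) \<le> v \<bullet> (A *\<^sub>v v)"
    and "\<And>\<nu>. (\<And>v. v \<in> carrier_vec n \<Longrightarrow> \<nu> * (v \<bullet> v) \<le> v \<bullet> (A *\<^sub>v v)) \<Longrightarrow> \<nu> \<le> \<mu>"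
proof -
  define S where "S = {\<mu>. \<forall>v \<in> carrier_vec n. \<mu> * (v \<bullet> v) \<le> v \<bullet> (A *\<^sub>v v)}"
  obtain K where K_bound: "\<And>v. v \<in> carrier_vec n \<Longrightarrow> \<bar>v \<bullet> (A *\<^sub>v v)\<bar> \<le> K * (v \<bullet> v)"
    using quadratic_form_bounded[OF A_carrier] by blast
  have "- K \<in> S" unfolding S_def using K_bound by (force simp: abs_le_iff)
  then have nonempty: "S \<noteq> {}" by auto
  have "\<nu> \<le> unit_vec n 0 \<bullet> (A *\<^sub>v unit_vec n 0)" if "\<nu> \<in> S" for \<nu>
    using that n_pos unfolding S_def by (auto dest!: bspec[of _ _ "unit_vec n 0"])
  then have bdd: "bdd_above S" by (rule bdd_aboveI)
  show ?thesis
  proof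
    show "\<nu> \<le> Sup S" if "\<And>v. v \<in> carrier_vec n \<Longrightarrow> \<nu> * (v \<bullet> v) \<le> v \<bullet> (A *\<^sub>v v)" for \<nu>
      using that by (intro cSup_upper[OF _ bdd]) (simp add: S_def)
    fix v :: "real vec" assume v_carrier: "v \<in> carrier_vec n"
    show "Sup S * (v \<bullet> v) \<le> v \<bullet> (A *\<^sub>v v)"
    proof (cases "v \<bullet> v = 0")
      case True
      then show ?thesis using K_bound[OF v_carrier] by simp
    next
      case False
      then have pos: "v \<bullet> v > 0" using scalar_prod_self_nonneg[of v] by linarith
      have "Sup S \<le> (v \<bullet> (A *\<^sub>v v)) / (v \<bullet> v)"
        using nonempty pos v_carrier by (intro cSup_least) (auto simp: S_def field_simps)
      then show ?thesis using pos by (simp add: field_simps)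
    qed
  qed
qed

text \<open>
  The largest \<open>\<mu>\<close> with \<open>A - \<mu> I\<close> positive semidefinite makes this matrix singular, because an invertible
  one would be uniformly positive definite.
\<close>
lemma rayleigh_lower_bound_eigenvalue:
  assumes A_sym: "symmetric_mat n A" and n_pos: "n > 0"
  obtains \<mu> where "eigenvalue A \<mu>" "\<And>v. v \<in> carrier_vec n \<Longrightarrow> \<mu> * (v \<bullet> v) \<le> v \<bullet> (A *\<^sub>v v)"
proof -
  note A_carrier = symmetric_mat_carrier[OF A_sym]
  obtain \<mu> where lower_bound: "\<And>v. v \<in> carrier_vec n \<Longrightarrow> \<mu> * (v \<bullet> v) \<le> v \<bullet> (A *\<^sub>v v)"
    and greatest: "\<And>\<nu>. (\<And>v. v \<in> carrier_vec n \<Longrightarrow> \<nu> * (v \<bullet> v) \<le> v \<bullet> (A *\<^sub>v v)) \<Longrightarrow> \<nu> \<le> \<mu>"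
    using greatest_rayleigh_lower_bound[OF A_carrier n_pos] by blast
  let ?C = "A + (- \<mu>) \<cdot>\<^sub>m 1\<^sub>m n"
  have form: "v \<bullet> (?C *\<^sub>v v) = v \<bullet> (A *\<^sub>v v) - \<mu> * (v \<bullet> v)" if v_carrier: "v \<in> carrier_vec n" for v
    using v_carrier A_carrier by (simp add: shift_mult_vec scalar_prod_add_distrib[of _ n])
  have "det ?C = 0"
  proof (rule ccontr)
    assume "det ?C \<noteq> 0"
    moreover have "psd_mat n ?C" using lower_bound by (simp add: psd_mat_def form)
    ultimately obtain e where e_bound: "e > 0" "\<And>v. v \<in> carrier_vec n \<Longrightarrow> e * (v \<bullet> v) \<le> v \<bullet> (?C *\<^sub>v v)"
      using psd_invertible_imp_pd[OF symmetric_mat_shift[OF A_sym]] by blast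
    have "\<mu> + e \<le> \<mu>" using e_bound(2) by (intro greatest) (force simp: form algebra_simps)
    then show False using e_bound(1) by simp
  qed
  then have "eigenvalue A \<mu>"
    using eigenvalue_det[OF A_carrier] A_carrier by (simp add: char_matrix_def)
  then show ?thesis using lower_bound that by blast
qed

lemma finite_eigenvalues:
  fixes A :: "'a::field mat"
  assumes "A \<in> carrier_mat n n"
  shows "finite {a. eigenvalue A a}"
proof -
  have "char_poly A \<noteq> 0" using degree_monic_char_poly[OF assms] by auto
  then have "finite {a. poly (char_poly A) a = 0}" by (rule poly_roots_finite)
  then show ?thesis using eigenvalue_root_char_poly[OF assms] by simp
qed

lemma eigenvalue_uminus:
  fixes A :: "'a::field mat"
  assumes A_carrier: "A \<in> carrier_mat n n" and "eigenvalue (- A) a"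
  shows "eigenvalue A (- a)"
proof -
  obtain z where z_eigen: "z \<in> carrier_vec n" "z \<noteq> 0\<^sub>v n" "- A *\<^sub>v z = a \<cdot>\<^sub>v z"
    using assms by (auto simp: eigenvalue_def eigenvector_def)
  have "- (A *\<^sub>v z) = a \<cdot>\<^sub>v z" using z_eigen A_carrier by simp
  then have "A *\<^sub>v z = - (a \<cdot>\<^sub>v z)" by (metis uminus_uminus_vec)
  also have "\<dots> = (- a) \<cdot>\<^sub>v z" by auto
  finally show ?thesis using z_eigen A_carrier by (auto simp: eigenvalue_def eigenvector_def)
qed

lemma quadratic_form_eig_bounds:
  assumes A_sym: "symmetric_mat n A" and n_pos: "n > 0" and v_carrier: "v \<in> carrier_vec n"
  shows "min_eig A * (v \<bullet> v) \<le> v \<bullet> (A *\<^sub>v v)" "v \<bullet> (A *\<^sub>v v) \<le> max_eig A * (v \<bullet> v)"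
proof -
  note A_carrier = symmetric_mat_carrier[OF A_sym]
  note fin = finite_eigenvalues[OF A_carrier]
  obtain \<mu> where mu_eig: "eigenvalue A \<mu>" "\<mu> * (v \<bullet> v) \<le> v \<bullet> (A *\<^sub>v v)"
    using rayleigh_lower_bound_eigenvalue[OF A_sym n_pos] v_carrier by metis
  have "min_eig A \<le> \<mu>" unfolding min_eig_def using fin mu_eig by (intro Min_le) auto
  then show "min_eig A * (v \<bullet> v) \<le> v \<bullet> (A *\<^sub>v v)"
    using mu_eig(2) mult_right_mono[OF _ scalar_prod_self_nonneg[of v]] by fastforce
  obtain \<nu> where nu_eig: "eigenvalue (- A) \<nu>" "\<nu> * (v \<bullet> v) \<le> v \<bullet> (- A *\<^sub>v v)"
    using rayleigh_lower_bound_eigenvalue[OF symmetric_mat_uminus[OF A_sym] n_pos] v_carrier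
    by metis
  have "- \<nu> \<le> max_eig A"
    unfolding max_eig_def using fin eigenvalue_uminus[OF A_carrier nu_eig(1)] by (intro Max_ge) auto
  moreover have "v \<bullet> (A *\<^sub>v v) \<le> - \<nu> * (v \<bullet> v)" using nu_eig(2) v_carrier A_carrier by simp
  ultimately show "v \<bullet> (A *\<^sub>v v) \<le> max_eig A * (v \<bullet> v)"
    using mult_right_mono[OF _ scalar_prod_self_nonneg[of v]] by fastforce
qed

definition poly_mult_vec :: "real mat \<Rightarrow> real poly \<Rightarrow> real vec \<Rightarrow> real vec" where
  "poly_mult_vec C p w = vec (dim_vec w) (\<lambda>t. \<Sum>j\<le>degree p. coeff p j * ((C ^\<^sub>m j) *\<^sub>v w) $ t)"

lemma scalar_prod_vec_sum:
  fixes z :: "'a::comm_semiring_0 vec"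
  assumes "\<And>j. j \<in> S \<Longrightarrow> f j \<in> carrier_vec n" "z \<in> carrier_vec n"
  shows "vec n (\<lambda>t. \<Sum>j\<in>S. c j * f j $ t) \<bullet> z = (\<Sum>j\<in>S. c j * (f j \<bullet> z))"
proof -
  have "vec n (\<lambda>t. \<Sum>j\<in>S. c j * f j $ t) \<bullet> z = (\<Sum>t<n. \<Sum>j\<in>S. c j * (f j $ t * z $ t))"
    using assms by (simp add: scalar_prod_def sum_distrib_right atLeast0LessThan mult.assoc)
  also have "\<dots> = (\<Sum>j\<in>S. \<Sum>t<n. c j * (f j $ t * z $ t))" by (rule sum.swap)
  finally show ?thesis using assms
    by (simp add: scalar_prod_def sum_distrib_left atLeast0LessThan)
qed

lemma poly_mult_vec_scalar_prod:
  assumes C_sym: "symmetric_mat n C" and w_carrier: "w \<in> carrier_vec n"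
  shows "poly_mult_vec C p w \<bullet> poly_mult_vec C q w
      = moment_functional (\<lambda>i. w \<bullet> ((C ^\<^sub>m i) *\<^sub>v w)) (p * q)"
    and "poly_mult_vec C p w \<bullet> (C *\<^sub>v poly_mult_vec C q w)
      = moment_functional (\<lambda>i. w \<bullet> ((C ^\<^sub>m i) *\<^sub>v w)) (pCons 0 (p * q))"
proof -
  note C_carrier = symmetric_mat_carrier[OF C_sym]
  let ?m = "\<lambda>i. w \<bullet> ((C ^\<^sub>m i) *\<^sub>v w)"
  have pow: "(C ^\<^sub>m i) *\<^sub>v w \<in> carrier_vec n" for i
    by (rule pow_mat_mult_vec_carrier[OF C_carrier w_carrier])
  have carrier: "poly_mult_vec C r w \<in> carrier_vec n" for r
    using w_carrier by (simp add: poly_mult_vec_def)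
  have expand: "poly_mult_vec C r w \<bullet> z = (\<Sum>j\<le>degree r. coeff r j * (((C ^\<^sub>m j) *\<^sub>v w) \<bullet> z))"
    if "z \<in> carrier_vec n" for r z
    unfolding poly_mult_vec_def carrier_vecD[OF w_carrier]
    by (rule scalar_prod_vec_sum) (use pow that in auto)
  have moment: "((C ^\<^sub>m i) *\<^sub>v w) \<bullet> poly_mult_vec C q w
      = (\<Sum>j\<le>degree q. coeff q j * ?m (i + j))" for i
    unfolding comm_scalar_prod[OF pow carrier] expand[OF pow]
      symmetric_mat_pow_scalar_prod[OF C_sym w_carrier w_carrier]
    by (simp add: add.commute)
  show "poly_mult_vec C p w \<bullet> poly_mult_vec C q w = moment_functional ?m (p * q)"
    unfolding expand[OF carrier] moment moment_functional_mult
    by (simp add: sum_distrib_left mult.assoc)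
  have "((C ^\<^sub>m i) *\<^sub>v w) \<bullet> (C *\<^sub>v poly_mult_vec C q w)
      = (\<Sum>j\<le>degree q. coeff q j * ?m (Suc i + j))" for i
    unfolding symmetric_mat_scalar_prod[OF C_sym pow carrier, symmetric]
      pow_mat_Suc_mult_vec(1)[OF C_carrier w_carrier, symmetric] moment ..
  then show "poly_mult_vec C p w \<bullet> (C *\<^sub>v poly_mult_vec C q w)
      = moment_functional ?m (pCons 0 (p * q))"
    unfolding expand[OF mult_mat_vec_carrier[OF C_carrier carrier]] moment_functional_pCons_0
      moment_functional_mult
    by (simp add: sum_distrib_left mult.assoc del: pow_mat.simps)
qed

locale pd_matrix =
  fixes n :: nat and C :: "real mat" and a b :: real
  assumes symmetric: "symmetric_mat n C"
    and lower_pos: "0 < a"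
    and lower: "v \<in> carrier_vec n \<Longrightarrow> a * (v \<bullet> v) \<le> v \<bullet> (C *\<^sub>v v)"
    and upper: "v \<in> carrier_vec n \<Longrightarrow> v \<bullet> (C *\<^sub>v v) \<le> b * (v \<bullet> v)"
begin

lemma carrier: "C \<in> carrier_mat n n"
  using symmetric by (rule symmetric_mat_carrier)

lemma form_nonneg: "v \<in> carrier_vec n \<Longrightarrow> 0 \<le> v \<bullet> (C *\<^sub>v v)"
  using lower[of v] lower_pos scalar_prod_self_nonneg[of v]
  by (meson mult_nonneg_nonneg less_imp_le order_trans)

lemma form_pos: "v \<in> carrier_vec n \<Longrightarrow> v \<noteq> 0\<^sub>v n \<Longrightarrow> 0 < v \<bullet> (C *\<^sub>v v)"
  using lower[of v] lower_pos scalar_prod_self_pos[of v n]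
  by (meson mult_pos_pos less_le_trans)

lemma psd: "psd_mat n C"
  by (simp add: psd_mat_def form_nonneg)

lemma lower_le_upper:
  assumes "n > 0"
  shows "a \<le> b"
  using lower[of "unit_vec n 0"] upper[of "unit_vec n 0"] assms by simp

lemma det_nonzero: "det C \<noteq> 0"
  using form_pos det_0_iff_vec_prod_zero[OF carrier] by force

lemmas mat_inv_carrier = mat_inv_inverse(1)[OF carrier det_nonzero]

lemma mat_inv_mult_vec_carrier: "v \<in> carrier_vec n \<Longrightarrow> mat_inv C *\<^sub>v v \<in> carrier_vec n"
  using mat_inv_carrier by simp

lemma mult_mat_inv_vec:
  assumes "v \<in> carrier_vec n"
  shows "C *\<^sub>v (mat_inv C *\<^sub>v v) = v"
  using assoc_mult_mat_vec[OF carrier mat_inv_carrier assms]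
    mat_inv_inverse(2)[OF carrier det_nonzero] assms
  by simp

lemma mat_inv_mult_vec:
  assumes "v \<in> carrier_vec n"
  shows "mat_inv C *\<^sub>v (C *\<^sub>v v) = v"
  using assoc_mult_mat_vec[OF mat_inv_carrier carrier assms]
    mat_inv_inverse(3)[OF carrier det_nonzero] assms
  by simp

lemma trs_multiplier_solution:
  assumes "trs_multiplier n A g \<Delta> x l" "C = A + l \<cdot>\<^sub>m 1\<^sub>m n" "x \<in> carrier_vec n"
  shows "x = - (mat_inv C *\<^sub>v g)"
proof -
  have "C *\<^sub>v (- x) = g"
    using assms carrier by (simp add: trs_multiplier_def mult_mat_vec_uminus)
  then show ?thesis using mat_inv_mult_vec[of "- x"] assms(3) by auto
qed

lemma mat_inv_mult_vec_nonzero: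
  assumes "v \<in> carrier_vec n" "v \<noteq> 0\<^sub>v n"
  shows "mat_inv C *\<^sub>v v \<noteq> 0\<^sub>v n"
proof
  assume "mat_inv C *\<^sub>v v = 0\<^sub>v n"
  then have "v = C *\<^sub>v 0\<^sub>v n" using mult_mat_inv_vec[OF assms(1)] by simp
  also have "\<dots> = 0\<^sub>v n" using carrier by (rule mult_mat_vec_zero)
  finally show False using assms(2) by simp
qed

lemma symmetric_mat_inv: "symmetric_mat n (mat_inv C)"
proof -
  note inv = mat_inv_inverse[OF carrier det_nonzero]
  let ?S = "mat_inv C"
  have "?S\<^sup>T * C = (C * ?S)\<^sup>T"
    using transpose_mult[OF carrier inv(1)] symmetric by (simp add: symmetric_mat_def)
  then have left: "?S\<^sup>T * C = 1\<^sub>m n" by (simp add: inv)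
  have "?S\<^sup>T = ?S\<^sup>T * (C * ?S)" using inv by simp
  also have "\<dots> = (?S\<^sup>T * C) * ?S"
    using inv carrier by (intro assoc_mult_mat[symmetric, of _ n n _ n _ n]) auto
  also have "\<dots> = ?S" using inv left by simp
  finally show ?thesis using inv by (simp add: symmetric_mat_def)
qed

lemma mat_inv_scalar_prod:
  "u \<in> carrier_vec n \<Longrightarrow> v \<in> carrier_vec n \<Longrightarrow> (mat_inv C *\<^sub>v u) \<bullet> v = u \<bullet> (mat_inv C *\<^sub>v v)"
  by (rule symmetric_mat_scalar_prod[OF symmetric_mat_inv])

lemma mat_inv_cube_form:
  assumes v_carrier: "v \<in> carrier_vec n"
  shows "v \<bullet> ((mat_inv C ^\<^sub>m 3) *\<^sub>v v) = (mat_inv C *\<^sub>v v) \<bullet> (mat_inv C *\<^sub>v (mat_inv C *\<^sub>v v))"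
  using symmetric_mat_pow_scalar_prod[OF symmetric_mat_inv v_carrier v_carrier, of 1 2] v_carrier
    pow_mat_Suc_mult_vec(1)[OF mat_inv_carrier v_carrier] mat_inv_carrier
  by (simp add: numeral_eq_Suc)

lemma mat_inv_cube_form_pos:
  assumes v_nonzero: "v \<in> carrier_vec n" "v \<noteq> 0\<^sub>v n"
  shows "0 < v \<bullet> ((mat_inv C ^\<^sub>m 3) *\<^sub>v v)"
proof -
  let ?x = "mat_inv C *\<^sub>v v"
  let ?w = "mat_inv C *\<^sub>v ?x"
  have x_nonzero: "?x \<in> carrier_vec n" "?x \<noteq> 0\<^sub>v n"
    using v_nonzero by (simp_all add: mat_inv_mult_vec_carrier mat_inv_mult_vec_nonzero)
  then have w_nonzero: "?w \<in> carrier_vec n" "?w \<noteq> 0\<^sub>v n"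
    by (simp_all add: mat_inv_mult_vec_carrier mat_inv_mult_vec_nonzero)
  have "?w \<bullet> (C *\<^sub>v ?w) = ?x \<bullet> ?w"
    using comm_scalar_prod[OF w_nonzero(1) x_nonzero(1)] by (simp add: mult_mat_inv_vec x_nonzero)
  then show ?thesis using form_pos[OF w_nonzero] by (simp add: mat_inv_cube_form v_nonzero)
qed

lemma variational_le_mat_inv_form:
  assumes z_carrier: "z \<in> carrier_vec n" and v_carrier: "v \<in> carrier_vec n"
  shows "2 * (z \<bullet> v) - z \<bullet> (C *\<^sub>v z) \<le> v \<bullet> (mat_inv C *\<^sub>v v)"
proof -
  let ?x = "mat_inv C *\<^sub>v v"
  have x_solves: "?x \<in> carrier_vec n" "C *\<^sub>v ?x = v"
    using v_carrier by (simp_all add: mat_inv_mult_vec_carrier mult_mat_inv_vec)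
  have "0 \<le> (z + (- 1) \<cdot>\<^sub>v ?x) \<bullet> (C *\<^sub>v (z + (- 1) \<cdot>\<^sub>v ?x))"
    using z_carrier x_solves by (intro form_nonneg) simp
  then show ?thesis
    unfolding quadratic_form_add_smult[OF symmetric z_carrier x_solves(1)]
    using comm_scalar_prod[OF v_carrier x_solves(1)] x_solves by simp
qed

lemma vnorm_mult_le:
  assumes "0 \<le> b" and v_carrier: "v \<in> carrier_vec n"
  shows "vnorm (C *\<^sub>v v) \<le> b * vnorm v"
proof -
  let ?u = "C *\<^sub>v v"
  have u_carrier: "?u \<in> carrier_vec n" using carrier v_carrier by simp
  have "(?u \<bullet> ?u) * (?u \<bullet> ?u) = (v \<bullet> (C *\<^sub>v ?u)) * (v \<bullet> (C *\<^sub>v ?u))"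
    using symmetric_mat_scalar_prod[OF symmetric v_carrier u_carrier] by simp
  also have "\<dots> \<le> (v \<bullet> (C *\<^sub>v v)) * (?u \<bullet> (C *\<^sub>v ?u))"
    by (rule psd_Cauchy_Schwarz[OF symmetric psd v_carrier u_carrier])
  also have "\<dots> \<le> (b * (v \<bullet> v)) * (b * (?u \<bullet> ?u))"
    using upper[OF v_carrier] upper[OF u_carrier] form_nonneg[OF u_carrier] \<open>0 \<le> b\<close>
      scalar_prod_self_nonneg[of v]
    by (intro mult_mono) auto
  finally have "(?u \<bullet> ?u) * (?u \<bullet> ?u) \<le> (b * b * (v \<bullet> v)) * (?u \<bullet> ?u)"
    by (simp add: mult_ac)
  then have "?u \<bullet> ?u \<le> b * b * (v \<bullet> v)"
    using scalar_prod_self_nonneg[of v] scalar_prod_self_nonneg[of ?u]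
    by (cases "?u \<bullet> ?u = 0") (auto simp: mult_le_cancel_right)
  then have "vnorm ?u \<le> sqrt (b * b * (v \<bullet> v))" by (simp add: vnorm_def)
  then show ?thesis using \<open>0 \<le> b\<close> by (simp add: vnorm_def real_sqrt_mult)
qed

lemma opnorm_bounds:
  assumes "n > 0"
  shows "0 < opnorm C" "opnorm C \<le> b"
proof -
  let ?e = "unit_vec n 0 :: real vec"
  let ?S = "{vnorm (C *\<^sub>v x) | x. x \<in> carrier_vec (dim_col C) \<and> vnorm x \<le> 1}"
  have e_unit: "?e \<in> carrier_vec n" "?e \<bullet> ?e = 1" using assms by auto
  have b_nonneg: "0 \<le> b" using lower_le_upper[OF assms] lower_pos by simp
  have in_S: "vnorm (C *\<^sub>v ?e) \<in> ?S" using carrier e_unit by (auto simp: vnorm_def)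
  have S_le: "s \<le> b" if s_in_S: "s \<in> ?S" for s
  proof -
    obtain x where s_eq: "s = vnorm (C *\<^sub>v x)" "x \<in> carrier_vec n" "vnorm x \<le> 1"
      using s_in_S carrier by auto
    have "s \<le> b * vnorm x" unfolding s_eq(1) by (rule vnorm_mult_le[OF b_nonneg s_eq(2)])
    also have "\<dots> \<le> b * 1" using s_eq b_nonneg by (intro mult_left_mono) auto
    finally show ?thesis by simp
  qed
  show "opnorm C \<le> b" unfolding opnorm_def using in_S S_le by (intro cSup_least) auto
  have "?e \<noteq> 0\<^sub>v n" using e_unit by (simp flip: scalar_prod_self_eq_0_iff)
  then have "C *\<^sub>v ?e \<noteq> 0\<^sub>v n" using form_pos[OF e_unit(1)] e_unit by auto
  then have "0 < vnorm (C *\<^sub>v ?e)" using carrier e_unit by (intro vnorm_pos[of _ n]) auto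
  also have "\<dots> \<le> opnorm C" unfolding opnorm_def
    using in_S S_le by (intro cSup_upper bdd_aboveI[of _ b]) auto
  finally show "0 < opnorm C" .
qed

lemma moments_on_form:
  assumes w_carrier: "w \<in> carrier_vec n"
  shows "moments_on a b (\<lambda>i. w \<bullet> ((C ^\<^sub>m i) *\<^sub>v w))" (is "moments_on a b ?m")
  unfolding moments_on_def
proof
  fix q :: "real poly"
  let ?u = "poly_mult_vec C q w"
  have u_carrier: "?u \<in> carrier_vec n" using w_carrier by (simp add: poly_mult_vec_def)
  note form = poly_mult_vec_scalar_prod[OF symmetric w_carrier, of q q, symmetric]
  have "q * q * [:-a, 1:] = pCons 0 (q * q) - Polynomial.smult a (q * q)"
    and "q * q * [:b, -1:] = Polynomial.smult b (q * q) - pCons 0 (q * q)"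
    by simp_all
  then show "0 \<le> moment_functional ?m (q * q) \<and> 0 \<le> moment_functional ?m (q * q * [:-a, 1:])
      \<and> 0 \<le> moment_functional ?m (q * q * [:b, -1:])"
    using lower[OF u_carrier] upper[OF u_carrier] scalar_prod_self_nonneg[of ?u]
    by (simp only: moment_functional_diff moment_functional_smult form) simp
qed

lemma mat_inv_pow_form:
  assumes v_carrier: "v \<in> carrier_vec n"
  shows "(mat_inv C *\<^sub>v v) \<bullet> ((C ^\<^sub>m (i + 2)) *\<^sub>v (mat_inv C *\<^sub>v v)) = v \<bullet> ((C ^\<^sub>m i) *\<^sub>v v)"
proof -
  let ?x = "mat_inv C *\<^sub>v v"
  have x_solves: "?x \<in> carrier_vec n" "C *\<^sub>v ?x = v"
    using v_carrier by (simp_all add: mat_inv_mult_vec_carrier mult_mat_inv_vec)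
  have "?x \<bullet> ((C ^\<^sub>m (1 + Suc i)) *\<^sub>v ?x) = ((C ^\<^sub>m 1) *\<^sub>v ?x) \<bullet> ((C ^\<^sub>m Suc i) *\<^sub>v ?x)"
    by (rule symmetric_mat_pow_scalar_prod[OF symmetric x_solves(1) x_solves(1), symmetric])
  also have "\<dots> = v \<bullet> ((C ^\<^sub>m i) *\<^sub>v v)"
    using x_solves carrier by (simp only: pow_mat_Suc_mult_vec(2)[OF carrier x_solves(1)]) simp
  finally show ?thesis by (simp only: add_2_eq_Suc' plus_1_eq_Suc)
qed

lemma shift_mult_product_nonneg:
  assumes psd_shift: "psd_mat n (C + \<mu> \<cdot>\<^sub>m 1\<^sub>m n)" and z_carrier: "z \<in> carrier_vec n"
  shows "0 \<le> (C *\<^sub>v z) \<bullet> (C *\<^sub>v z + \<mu> \<cdot>\<^sub>v z)"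
proof (cases "0 \<le> \<mu>")
  case True
  have Cz_carrier: "C *\<^sub>v z \<in> carrier_vec n" using carrier z_carrier by simp
  have "(C *\<^sub>v z) \<bullet> (C *\<^sub>v z + \<mu> \<cdot>\<^sub>v z) = (C *\<^sub>v z) \<bullet> (C *\<^sub>v z) + \<mu> * (z \<bullet> (C *\<^sub>v z))"
    using Cz_carrier z_carrier comm_scalar_prod[OF Cz_carrier z_carrier]
    by (simp add: scalar_prod_add_distrib[of _ n])
  then show ?thesis
    using True form_nonneg[OF z_carrier] scalar_prod_self_nonneg[of "C *\<^sub>v z"] by simp
next
  case False
  define u where "u = C *\<^sub>v z + \<mu> \<cdot>\<^sub>v z"
  have u_carrier: "u \<in> carrier_vec n" using carrier z_carrier by (simp add: u_def)
  have "C *\<^sub>v z = u + (- \<mu>) \<cdot>\<^sub>v z" using carrier z_carrier by (intro eq_vecI) (auto simp: u_def)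
  then have "(C *\<^sub>v z) \<bullet> u = u \<bullet> u + (- \<mu>) * (z \<bullet> u)"
    using u_carrier z_carrier by (simp add: add_scalar_prod_distrib[of _ n])
  moreover have "0 \<le> z \<bullet> u"
    using psd_shift z_carrier carrier by (auto simp: psd_mat_def u_def shift_mult_vec)
  then have "0 \<le> (- \<mu>) * (z \<bullet> u)" using False by (intro mult_nonneg_nonneg) auto
  ultimately show ?thesis using scalar_prod_self_nonneg[of u] by (simp flip: u_def)
qed

text \<open>
  The tangent at 0 of the convex function \<open>\<mu> \<mapsto> \<parallel>(C + \<mu> I)\<^sup>-\<^sup>1 v\<parallel>\<^sup>2\<close>. With \<open>h = C (C z)\<close>, the difference
  of the two sides is \<open>\<mu>\<^sup>2 (\<parallel>C z\<parallel>\<^sup>2 + 2 (C z) \<bullet> (C z + \<mu> z))\<close>.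
\<close>
lemma shifted_solution_norm_tangent:
  assumes v_carrier: "v \<in> carrier_vec n"
    and h_solves: "h \<in> carrier_vec n" "(C + \<mu> \<cdot>\<^sub>m 1\<^sub>m n) *\<^sub>v h = v"
    and psd_shift: "psd_mat n (C + \<mu> \<cdot>\<^sub>m 1\<^sub>m n)"
  shows "(mat_inv C *\<^sub>v v) \<bullet> (mat_inv C *\<^sub>v v) - 2 * \<mu> * (v \<bullet> ((mat_inv C ^\<^sub>m 3) *\<^sub>v v)) \<le> h \<bullet> h"
proof -
  define u where "u = mat_inv C *\<^sub>v h"
  define z where "z = mat_inv C *\<^sub>v u"
  have u_solves: "u \<in> carrier_vec n" "C *\<^sub>v u = h" and z_solves: "z \<in> carrier_vec n" "C *\<^sub>v z = u"
    using h_solves by (simp_all add: u_def z_def mat_inv_mult_vec_carrier mult_mat_inv_vec)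
  have "v = C *\<^sub>v h + \<mu> \<cdot>\<^sub>v h" using h_solves shift_mult_vec[OF carrier h_solves(1), of \<mu>] by simp
  then have x_eq: "mat_inv C *\<^sub>v v = h + \<mu> \<cdot>\<^sub>v u"
    using h_solves carrier
    by (simp add: mult_add_distrib_mat_vec[OF mat_inv_carrier] mult_mat_vec[OF mat_inv_carrier]
        mat_inv_mult_vec flip: u_def)
  then have w_eq: "mat_inv C *\<^sub>v (mat_inv C *\<^sub>v v) = u + \<mu> \<cdot>\<^sub>v z"
    using h_solves u_solves
    by (simp add: mult_add_distrib_mat_vec[OF mat_inv_carrier] mult_mat_vec[OF mat_inv_carrier]
        flip: u_def z_def)
  have h_z: "h \<bullet> z = u \<bullet> u"
    using symmetric_mat_scalar_prod[OF symmetric u_solves(1) z_solves(1)] u_solves z_solves by simp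
  have scalar_prod_comm: "h \<bullet> u = u \<bullet> h" "z \<bullet> u = u \<bullet> z"
    using comm_scalar_prod h_solves u_solves z_solves by blast+
  have "(mat_inv C *\<^sub>v v) \<bullet> (mat_inv C *\<^sub>v v) = h \<bullet> h + 2 * \<mu> * (u \<bullet> h) + \<mu> * \<mu> * (u \<bullet> u)"
    unfolding x_eq using h_solves u_solves scalar_prod_comm
    by (simp add: add_scalar_prod_distrib[of _ n] scalar_prod_add_distrib[of _ n] algebra_simps)
  moreover have "v \<bullet> ((mat_inv C ^\<^sub>m 3) *\<^sub>v v) = u \<bullet> h + 2 * \<mu> * (u \<bullet> u) + \<mu> * \<mu> * (u \<bullet> z)"
    unfolding mat_inv_cube_form[OF v_carrier] w_eq unfolding x_eq
    using h_solves u_solves z_solves h_z scalar_prod_comm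
    by (simp add: add_scalar_prod_distrib[of _ n] scalar_prod_add_distrib[of _ n] algebra_simps)
  ultimately have "h \<bullet> h
      - ((mat_inv C *\<^sub>v v) \<bullet> (mat_inv C *\<^sub>v v) - 2 * \<mu> * (v \<bullet> ((mat_inv C ^\<^sub>m 3) *\<^sub>v v)))
      = \<mu> * \<mu> * (u \<bullet> u + 2 * (u \<bullet> u + \<mu> * (u \<bullet> z)))"
    by (simp add: algebra_simps)
  moreover have "0 \<le> u \<bullet> u + \<mu> * (u \<bullet> z)"
    using shift_mult_product_nonneg[OF psd_shift z_solves(1)] u_solves z_solves
    by (simp add: scalar_prod_add_distrib[of _ n])
  then have "0 \<le> \<mu> * \<mu> * (u \<bullet> u + 2 * (u \<bullet> u + \<mu> * (u \<bullet> z)))"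
    using scalar_prod_self_nonneg[of u] by (intro mult_nonneg_nonneg[OF zero_le_square]) simp
  ultimately show ?thesis by linarith
qed

end

lemma pd_matrix_eig_shift:
  assumes A_sym: "symmetric_mat n A" and "n > 0" and "- min_eig A < l"
  shows "pd_matrix n (A + l \<cdot>\<^sub>m 1\<^sub>m n) (min_eig A + l) (max_eig A + l)"
proof
  show "symmetric_mat n (A + l \<cdot>\<^sub>m 1\<^sub>m n)" using A_sym by (rule symmetric_mat_shift)
  show "0 < min_eig A + l" using assms(3) by simp
  fix v :: "real vec" assume v_carrier: "v \<in> carrier_vec n"
  have "v \<bullet> ((A + l \<cdot>\<^sub>m 1\<^sub>m n) *\<^sub>v v) = v \<bullet> (A *\<^sub>v v) + l * (v \<bullet> v)"
    using v_carrier symmetric_mat_carrier[OF A_sym]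
    by (simp add: shift_mult_vec scalar_prod_add_distrib[of _ n])
  then show "(min_eig A + l) * (v \<bullet> v) \<le> v \<bullet> ((A + l \<cdot>\<^sub>m 1\<^sub>m n) *\<^sub>v v)"
    and "v \<bullet> ((A + l \<cdot>\<^sub>m 1\<^sub>m n) *\<^sub>v v) \<le> (max_eig A + l) * (v \<bullet> v)"
    using quadratic_form_eig_bounds[OF A_sym \<open>n > 0\<close> v_carrier] by (simp_all add: distrib_right)
qed

section \<open>Krylov spaces and the Lanczos projection\<close>

lemma lspan_carrier: "u \<in> lspan n v j \<Longrightarrow> u \<in> carrier_vec n"
  by (auto simp: lspan_def)

lemma zero_in_lspan: "0\<^sub>v n \<in> lspan n v j"
  unfolding lspan_def by (auto intro!: exI[of _ "\<lambda>_. 0"])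

lemma lspan_add:
  assumes "u \<in> lspan n v j" "u' \<in> lspan n v j"
  shows "u + u' \<in> lspan n v j"
proof -
  obtain c c' where "u = vec n (\<lambda>i. \<Sum>l<j. c l * v l $ i)" "u' = vec n (\<lambda>i. \<Sum>l<j. c' l * v l $ i)"
    using assms unfolding lspan_def by blast
  then have "u + u' = vec n (\<lambda>i. \<Sum>l<j. (c l + c' l) * v l $ i)"
    by (intro eq_vecI) (auto simp: distrib_right sum.distrib)
  then show ?thesis unfolding lspan_def by (auto intro!: exI[of _ "\<lambda>l. c l + c' l"])
qed

lemma lspan_smult:
  assumes "u \<in> lspan n v j"
  shows "r \<cdot>\<^sub>v u \<in> lspan n v j"
proof -
  obtain c where "u = vec n (\<lambda>i. \<Sum>l<j. c l * v l $ i)"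
    using assms unfolding lspan_def by blast
  then have "r \<cdot>\<^sub>v u = vec n (\<lambda>i. \<Sum>l<j. (r * c l) * v l $ i)"
    by (intro eq_vecI) (auto simp: sum_distrib_left mult.assoc)
  then show ?thesis unfolding lspan_def by (auto intro!: exI[of _ "\<lambda>l. r * c l"])
qed

lemma generator_in_lspan:
  assumes "v l \<in> carrier_vec n" "l < j"
  shows "v l \<in> lspan n v j"
proof -
  have "(\<Sum>i<j. (if i = l then 1 else 0) * v i $ t) = v l $ t" for t
    using assms(2) by (simp add: if_distrib[of "\<lambda>x. x * _"] cong: if_cong)
  then have "v l = vec n (\<lambda>t. \<Sum>i<j. (if i = l then 1 else 0) * v i $ t)"
    using assms(1) by (intro eq_vecI) auto
  then show ?thesis unfolding lspan_def by (auto intro!: exI[of _ "\<lambda>i. if i = l then 1 else 0"])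
qed

lemma lspan_induct [consumes 1, case_names carrier zero add]:
  assumes "u \<in> lspan n v j"
    and carrier: "\<And>l. l < j \<Longrightarrow> v l \<in> carrier_vec n"
    and "P (0\<^sub>v n)"
    and "\<And>u r l. u \<in> carrier_vec n \<Longrightarrow> P u \<Longrightarrow> l < j \<Longrightarrow> P (u + r \<cdot>\<^sub>v v l)"
  shows "P u"
proof -
  obtain c where u_eq: "u = vec n (\<lambda>i. \<Sum>l<j. c l * v l $ i)"
    using assms(1) unfolding lspan_def by blast
  have "P (vec n (\<lambda>i. \<Sum>l<m. c l * v l $ i))" if "m \<le> j" for m
    using that
  proof (induction m)
    case 0
    have "vec n (\<lambda>i. \<Sum>l<0. c l * v l $ i) = 0\<^sub>v n" by (intro eq_vecI) auto
    then show ?case using assms(3) by simp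
  next
    case (Suc m)
    have "vec n (\<lambda>i. \<Sum>l<Suc m. c l * v l $ i) = vec n (\<lambda>i. \<Sum>l<m. c l * v l $ i) + c m \<cdot>\<^sub>v v m"
      using carrier[of m] Suc.prems by (intro eq_vecI) auto
    then show ?case using Suc by (auto intro: assms(4))
  qed
  then show ?thesis by (simp add: u_eq)
qed

lemma lspan_subset:
  assumes "\<And>l. l < j \<Longrightarrow> v l \<in> lspan n w m"
  shows "lspan n v j \<subseteq> lspan n w m"
proof
  fix u assume "u \<in> lspan n v j"
  then show "u \<in> lspan n w m"
    by (induction rule: lspan_induct)
      (auto intro: assms lspan_carrier zero_in_lspan lspan_add lspan_smult)
qed

context
  fixes n :: nat and A :: "real mat" and g :: "real vec"
  assumes A_carrier: "A \<in> carrier_mat n n" and g_carrier: "g \<in> carrier_vec n"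
begin

lemma power_in_krylov: "i < j \<Longrightarrow> (A ^\<^sub>m i) *\<^sub>v g \<in> krylov n A g j"
  unfolding krylov_def
  by (rule generator_in_lspan) (rule pow_mat_mult_vec_carrier[OF A_carrier g_carrier])

lemma krylov_mono: "i \<le> j \<Longrightarrow> krylov n A g i \<subseteq> krylov n A g j"
  unfolding krylov_def
  by (rule lspan_subset) (auto simp flip: krylov_def intro: power_in_krylov)

lemma mult_in_krylov_Suc:
  assumes "v \<in> krylov n A g j"
  shows "A *\<^sub>v v \<in> krylov n A g (Suc j)"
  using assms unfolding krylov_def
proof (induction rule: lspan_induct)
  case (add u r l)
  have pow: "(A ^\<^sub>m l) *\<^sub>v g \<in> carrier_vec n"
    by (rule pow_mat_mult_vec_carrier[OF A_carrier g_carrier])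
  have "A *\<^sub>v (u + r \<cdot>\<^sub>v ((A ^\<^sub>m l) *\<^sub>v g)) = A *\<^sub>v u + r \<cdot>\<^sub>v ((A ^\<^sub>m Suc l) *\<^sub>v g)"
    using A_carrier add.hyps(1) pow unfolding pow_mat_Suc_mult_vec(1)[OF A_carrier g_carrier]
    by (simp add: mult_add_distrib_mat_vec[of A n n] mult_mat_vec[of A n n])
  also have "\<dots> \<in> krylov n A g (Suc j)"
    using add power_in_krylov[of "Suc l" "Suc j"] unfolding krylov_def
    by (intro lspan_add lspan_smult) auto
  finally show ?case by (simp add: krylov_def)
next
  case zero
  show ?case using mult_mat_vec_zero[OF A_carrier] by (simp add: zero_in_lspan)
qed (rule pow_mat_mult_vec_carrier[OF A_carrier g_carrier])

lemma krylov_shift_subset: "krylov n (A + l \<cdot>\<^sub>m 1\<^sub>m n) g j \<subseteq> krylov n A g j"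
proof -
  let ?B = "A + l \<cdot>\<^sub>m 1\<^sub>m n"
  have B_carrier: "?B \<in> carrier_mat n n" using A_carrier by simp
  have "(?B ^\<^sub>m i) *\<^sub>v g \<in> krylov n A g (Suc i)" for i
  proof (induction i)
    case 0
    then show ?case using power_in_krylov[of 0 1] A_carrier g_carrier by simp
  next
    case (Suc i)
    let ?v = "(?B ^\<^sub>m i) *\<^sub>v g"
    have "?v \<in> carrier_vec n" by (rule pow_mat_mult_vec_carrier[OF B_carrier g_carrier])
    then have "(?B ^\<^sub>m Suc i) *\<^sub>v g = A *\<^sub>v ?v + l \<cdot>\<^sub>v ?v"
      by (simp only: pow_mat_Suc_mult_vec(1)[OF B_carrier g_carrier] shift_mult_vec[OF A_carrier])
    moreover have "A *\<^sub>v ?v \<in> krylov n A g (Suc (Suc i))" by (rule mult_in_krylov_Suc[OF Suc])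
    moreover have "?v \<in> krylov n A g (Suc (Suc i))"
      using Suc krylov_mono[of "Suc i" "Suc (Suc i)"] by auto
    ultimately show ?case by (simp add: krylov_def lspan_add lspan_smult)
  qed
  then show ?thesis
    using krylov_mono unfolding krylov_def[of n ?B] krylov_def[of n A g j]
    by (intro lspan_subset) (auto simp flip: krylov_def dest!: Suc_leI)
qed

end

lemma krylov_shift:
  assumes A_carrier: "A \<in> carrier_mat n n" and g_carrier: "g \<in> carrier_vec n"
  shows "krylov n (A + l \<cdot>\<^sub>m 1\<^sub>m n) g j = krylov n A g j"
proof
  show "krylov n (A + l \<cdot>\<^sub>m 1\<^sub>m n) g j \<subseteq> krylov n A g j"
    by (rule krylov_shift_subset[OF A_carrier g_carrier])
  have "A + l \<cdot>\<^sub>m 1\<^sub>m n + (- l) \<cdot>\<^sub>m 1\<^sub>m n = A" using A_carrier by (intro eq_matI) auto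
  then show "krylov n A g j \<subseteq> krylov n (A + l \<cdot>\<^sub>m 1\<^sub>m n) g j"
    using krylov_shift_subset[of "A + l \<cdot>\<^sub>m 1\<^sub>m n" n g "- l" j] A_carrier g_carrier by simp
qed

lemma Qmat_carrier: "Qmat n k q \<in> carrier_mat n k"
  by (simp add: Qmat_def mat_of_cols_def)

lemma Qmat_mult_vec:
  assumes "\<And>l. l < k \<Longrightarrow> q l \<in> carrier_vec n" "c \<in> carrier_vec k"
  shows "Qmat n k q *\<^sub>v c = vec n (\<lambda>i. \<Sum>l<k. c $ l * q l $ i)"
  using assms by (intro eq_vecI)
    (auto simp: Qmat_def scalar_prod_def mat_of_cols_def atLeast0LessThan mult.commute intro!: sum.cong)

locale lanczos =
  fixes n k :: nat and B :: "real mat" and g :: "real vec" and q :: "nat \<Rightarrow> real vec"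
  assumes symmetric: "symmetric_mat n B"
    and g_carrier: "g \<in> carrier_vec n" and g_nonzero: "g \<noteq> 0\<^sub>v n"
    and k_pos: "1 \<le> k"
    and lanczos_vecs: "lanczos_vecs n B g k q"
begin

abbreviation "Q \<equiv> Qmat n k q"
abbreviation "T \<equiv> Tmat n k q B"
abbreviation "c \<equiv> vnorm g \<cdot>\<^sub>v unit_vec k 0"

lemma mat_carrier: "B \<in> carrier_mat n n"
  using symmetric by (rule symmetric_mat_carrier)

lemma n_pos: "0 < n"
  using g_carrier g_nonzero by (cases n) (auto intro!: eq_vecI)

lemma vecs_carrier: "i < k \<Longrightarrow> q i \<in> carrier_vec n"
  using lanczos_vecs by (simp add: lanczos_vecs_def)

lemma Q_orthonormal: "Q\<^sup>T * Q = 1\<^sub>m k"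
  using Qmat_carrier[of n k q] lanczos_vecs vecs_carrier
  by (intro eq_matI) (auto simp: lanczos_vecs_def Qmat_def)

lemma transpose_Q_mult_Q: "v \<in> carrier_vec k \<Longrightarrow> Q\<^sup>T *\<^sub>v (Q *\<^sub>v v) = v"
  using assoc_mult_mat_vec[of "Q\<^sup>T" k n Q k v] Qmat_carrier[of n k q] by (simp add: Q_orthonormal)

lemma scalar_prod_transpose_Q:
  assumes "u \<in> carrier_vec k" "z \<in> carrier_vec n"
  shows "u \<bullet> (Q\<^sup>T *\<^sub>v z) = (Q *\<^sub>v u) \<bullet> z"
  using transpose_vec_mult_scalar[OF Qmat_carrier assms] Qmat_carrier[of n k q] assms
    comm_scalar_prod[of u k "Q\<^sup>T *\<^sub>v z"] comm_scalar_prod[of "Q *\<^sub>v u" n z]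
  by simp

lemma Q_isometry:
  "u \<in> carrier_vec k \<Longrightarrow> v \<in> carrier_vec k \<Longrightarrow> (Q *\<^sub>v u) \<bullet> (Q *\<^sub>v v) = u \<bullet> v"
  using scalar_prod_transpose_Q[of u "Q *\<^sub>v v"] transpose_Q_mult_Q[of v] Qmat_carrier[of n k q]
  by simp

lemma Q_projection_krylov:
  assumes "v \<in> krylov n B g k"
  shows "Q *\<^sub>v (Q\<^sup>T *\<^sub>v v) = v"
proof -
  have "lspan n q k = krylov n B g k" using lanczos_vecs k_pos by (simp add: lanczos_vecs_def)
  then obtain d where "v = vec n (\<lambda>i. \<Sum>l<k. d l * q l $ i)"
    using assms unfolding lspan_def by blast
  then have "v = Q *\<^sub>v vec k d"
    using Qmat_mult_vec[of k q n "vec k d"] vecs_carrier by simp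
  then show ?thesis using transpose_Q_mult_Q[of "vec k d"] by simp
qed

lemma Q_mult_c: "Q *\<^sub>v c = g"
proof -
  have "Q *\<^sub>v c = vec n (\<lambda>i. \<Sum>l<k. c $ l * q l $ i)"
    using vecs_carrier by (intro Qmat_mult_vec) auto
  also have "\<dots> = vec n (\<lambda>i. \<Sum>l\<in>{0}. vnorm g * q l $ i)"
    using k_pos by (intro arg_cong[where f = "vec n"] ext sum.mono_neutral_cong_right) auto
  also have "\<dots> = g"
    using lanczos_vecs vnorm_pos[OF g_carrier g_nonzero] g_carrier
    by (intro eq_vecI) (auto simp: lanczos_vecs_def)
  finally show ?thesis .
qed

lemma T_carrier: "T \<in> carrier_mat k k"
  using Qmat_carrier[of n k q] mat_carrier by (simp add: Tmat_def)

lemma symmetric_T: "symmetric_mat k T"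
proof -
  note Q = Qmat_carrier[of n k q]
  have "T\<^sup>T = T"
    unfolding Tmat_def using Q mat_carrier symmetric
    by (simp add: transpose_mult[of _ k n _ k] transpose_mult[of _ n n _ k] symmetric_mat_def
        assoc_mult_mat[of _ k n _ n _ k])
  then show ?thesis using T_carrier by (simp add: symmetric_mat_def)
qed

lemma T_mult_vec:
  assumes v_carrier: "v \<in> carrier_vec k"
  shows "T *\<^sub>v v = Q\<^sup>T *\<^sub>v (B *\<^sub>v (Q *\<^sub>v v))"
  unfolding Tmat_def using Qmat_carrier[of n k q] mat_carrier v_carrier
  by (simp add: assoc_mult_mat_vec[of _ k n _ k] assoc_mult_mat_vec[of _ k n _ n])

lemma T_form:
  assumes u_carrier: "u \<in> carrier_vec k" and v_carrier: "v \<in> carrier_vec k"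
  shows "u \<bullet> (T *\<^sub>v v) = (Q *\<^sub>v u) \<bullet> (B *\<^sub>v (Q *\<^sub>v v))"
  unfolding T_mult_vec[OF v_carrier]
  by (intro scalar_prod_transpose_Q u_carrier v_carrier
      mult_mat_vec_carrier[OF mat_carrier] mult_mat_vec_carrier[OF Qmat_carrier])

lemma T_shift: "Tmat n k q (B + l \<cdot>\<^sub>m 1\<^sub>m n) = T + l \<cdot>\<^sub>m 1\<^sub>m k"
proof -
  note Q = Qmat_carrier[of n k q]
  have "Q\<^sup>T * (B + l \<cdot>\<^sub>m 1\<^sub>m n) = Q\<^sup>T * B + l \<cdot>\<^sub>m Q\<^sup>T"
    using Q mat_carrier
    by (simp add: mult_add_distrib_mat[of _ k n _ n] mult_smult_distrib[of _ k n _ n])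
  then show ?thesis
    unfolding Tmat_def using Q mat_carrier
    by (simp add: add_mult_distrib_mat[of _ k n _ _ k] mult_smult_assoc_mat[of _ k n _ k] Q_orthonormal)
qed

lemma lanczos_shift: "lanczos n k (B + l \<cdot>\<^sub>m 1\<^sub>m n) g q"
  using symmetric_mat_shift[OF symmetric] g_carrier g_nonzero k_pos lanczos_vecs
  by (auto simp: lanczos_def lanczos_vecs_def krylov_shift[OF mat_carrier g_carrier])

lemma gltr_multiplier_shift:
  assumes h_carrier: "h \<in> carrier_vec k" and multiplier: "trs_multiplier k T c \<Delta> h l'"
  shows "(Tmat n k q (B + l \<cdot>\<^sub>m 1\<^sub>m n) + (l' - l) \<cdot>\<^sub>m 1\<^sub>m k) *\<^sub>v (- h) = c"
    and "psd_mat k (Tmat n k q (B + l \<cdot>\<^sub>m 1\<^sub>m n) + (l' - l) \<cdot>\<^sub>m 1\<^sub>m k)"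
proof -
  have shift: "Tmat n k q (B + l \<cdot>\<^sub>m 1\<^sub>m n) + (l' - l) \<cdot>\<^sub>m 1\<^sub>m k = T + l' \<cdot>\<^sub>m 1\<^sub>m k"
    unfolding T_shift using T_carrier by (intro eq_matI) auto
  show "psd_mat k (Tmat n k q (B + l \<cdot>\<^sub>m 1\<^sub>m n) + (l' - l) \<cdot>\<^sub>m 1\<^sub>m k)"
    and "(Tmat n k q (B + l \<cdot>\<^sub>m 1\<^sub>m n) + (l' - l) \<cdot>\<^sub>m 1\<^sub>m k) *\<^sub>v (- h) = c"
    using multiplier h_carrier T_carrier unfolding shift
    by (simp_all add: trs_multiplier_def mult_mat_vec_uminus)
qed

lemma Q_mult_T_power:
  "j < k \<Longrightarrow> Q *\<^sub>v ((T ^\<^sub>m j) *\<^sub>v c) = (B ^\<^sub>m j) *\<^sub>v g"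
proof (induction j)
  case 0
  then show ?case using Q_mult_c T_carrier mat_carrier g_carrier by simp
next
  case (Suc j)
  have c_carrier: "c \<in> carrier_vec k" by simp
  have "(B ^\<^sub>m Suc j) *\<^sub>v g \<in> krylov n B g k"
    using Suc.prems by (rule power_in_krylov[OF mat_carrier g_carrier])
  moreover have "(T ^\<^sub>m Suc j) *\<^sub>v c = Q\<^sup>T *\<^sub>v ((B ^\<^sub>m Suc j) *\<^sub>v g)"
    using Suc T_mult_vec[OF pow_mat_mult_vec_carrier[OF T_carrier c_carrier]]
    by (simp only: pow_mat_Suc_mult_vec(1)[OF T_carrier c_carrier]
        pow_mat_Suc_mult_vec(1)[OF mat_carrier g_carrier])
  ultimately show ?case by (simp only: Q_projection_krylov)
qed

lemma gauss_quadrature_exact: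
  assumes "i \<le> 2 * k - 1"
  shows "g \<bullet> ((B ^\<^sub>m i) *\<^sub>v g) = c \<bullet> ((T ^\<^sub>m i) *\<^sub>v c)"
proof -
  have c_carrier: "c \<in> carrier_vec k" by simp
  have pow: "(T ^\<^sub>m j) *\<^sub>v c \<in> carrier_vec k" for j
    by (rule pow_mat_mult_vec_carrier[OF T_carrier c_carrier])
  note split_B = symmetric_mat_pow_scalar_prod[OF symmetric g_carrier g_carrier, symmetric]
  note split_T = symmetric_mat_pow_scalar_prod[OF symmetric_T c_carrier c_carrier, symmetric]
  show ?thesis
  proof (cases "i = 2 * k - 1")
    case True
    then have i_odd: "i = (k - 1) + Suc (k - 1)" using k_pos by simp
    show ?thesis
      unfolding i_odd split_B split_T pow_mat_Suc_mult_vec(1)[OF T_carrier c_carrier]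
        pow_mat_Suc_mult_vec(1)[OF mat_carrier g_carrier] T_form[OF pow pow]
      using k_pos by (simp add: Q_mult_T_power)
  next
    case False
    define r where "r = i div 2"
    define s where "s = i - r"
    have i_split: "i = r + s" "r < k" "s < k" using False assms k_pos by (auto simp: r_def s_def)
    show ?thesis
      unfolding i_split(1) split_B split_T Q_isometry[OF pow pow, symmetric]
        Q_mult_T_power[OF i_split(2)] Q_mult_T_power[OF i_split(3)] ..
  qed
qed

end

section \<open>The error of the projected problem\<close>

locale pd_lanczos = lanczos n k B g q + B: pd_matrix n B a b
  for n k :: nat and B :: "real mat" and g :: "real vec" and q :: "nat \<Rightarrow> real vec" and a b :: real
begin

sublocale T: pd_matrix k T a b
proof
  fix v :: "real vec" assume v_carrier: "v \<in> carrier_vec k"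
  have Qv_carrier: "Q *\<^sub>v v \<in> carrier_vec n"
    using Qmat_carrier v_carrier by (rule mult_mat_vec_carrier)
  show "a * (v \<bullet> v) \<le> v \<bullet> (T *\<^sub>v v)" "v \<bullet> (T *\<^sub>v v) \<le> b * (v \<bullet> v)"
    using B.lower[OF Qv_carrier] B.upper[OF Qv_carrier]
    by (simp_all add: T_form Q_isometry v_carrier)
qed (rule symmetric_T B.lower_pos)+

abbreviation "x \<equiv> mat_inv B *\<^sub>v g"
abbreviation "w \<equiv> mat_inv B *\<^sub>v x"
abbreviation "\<kappa> \<equiv> b / a"

lemma bounds: "0 < a" "a \<le> b"
  using B.lower_pos B.lower_le_upper[OF n_pos] by auto

lemma x_carrier: "x \<in> carrier_vec n" and w_carrier: "w \<in> carrier_vec n"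
  using g_carrier by (simp_all add: B.mat_inv_mult_vec_carrier)

lemma w_nonzero: "w \<noteq> 0\<^sub>v n"
  using g_carrier g_nonzero
  by (simp add: B.mat_inv_mult_vec_nonzero B.mat_inv_mult_vec_carrier)

lemma projected_energy_le: "c \<bullet> (mat_inv T *\<^sub>v c) \<le> g \<bullet> x"
proof -
  let ?x' = "mat_inv T *\<^sub>v c"
  have x'_solves: "?x' \<in> carrier_vec k" "T *\<^sub>v ?x' = c"
    by (simp_all add: T.mat_inv_mult_vec_carrier T.mult_mat_inv_vec)
  have z_carrier: "Q *\<^sub>v ?x' \<in> carrier_vec n"
    using Qmat_carrier x'_solves(1) by (rule mult_mat_vec_carrier)
  have "(Q *\<^sub>v ?x') \<bullet> g = c \<bullet> ?x'"
    using Q_isometry[OF x'_solves(1), of c] comm_scalar_prod[of c k ?x'] x'_solves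
    by (simp add: Q_mult_c)
  moreover have "(Q *\<^sub>v ?x') \<bullet> (B *\<^sub>v (Q *\<^sub>v ?x')) = c \<bullet> ?x'"
    using T_form[OF x'_solves(1) x'_solves(1)] comm_scalar_prod[of c k ?x'] x'_solves by simp
  ultimately show ?thesis using B.variational_le_mat_inv_form[OF z_carrier g_carrier] by simp
qed

lemma solution_norm_gap:
  "x \<bullet> x - (mat_inv T *\<^sub>v c) \<bullet> (mat_inv T *\<^sub>v c)
    \<le> 4 * chebyshev_rate \<kappa> ^ (2 * k) * (x \<bullet> x + 2 * real k * sqrt \<kappa> / b * (g \<bullet> x))"
proof -
  let ?x' = "mat_inv T *\<^sub>v c"
  define m where "m = (\<lambda>i. x \<bullet> ((B ^\<^sub>m i) *\<^sub>v x))"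
  define m' where "m' = (\<lambda>i. ?x' \<bullet> ((T ^\<^sub>m i) *\<^sub>v ?x'))"
  have c_carrier: "c \<in> carrier_vec k" by simp
  have x'_solves: "?x' \<in> carrier_vec k" "T *\<^sub>v ?x' = c"
    by (simp_all add: T.mat_inv_mult_vec_carrier T.mult_mat_inv_vec)
  have m_0: "m 0 = x \<bullet> x" "m' 0 = ?x' \<bullet> ?x'"
    using mat_carrier T_carrier x_carrier x'_solves by (simp_all add: m_def m'_def)
  have m_1: "m 1 = g \<bullet> x" "m' 1 = c \<bullet> ?x'"
    using mat_carrier T_carrier x_carrier x'_solves g_carrier
      comm_scalar_prod[OF x_carrier g_carrier] comm_scalar_prod[OF x'_solves(1) c_carrier]
    by (simp_all add: m_def m'_def B.mult_mat_inv_vec)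
  have "m 0 - m' 0 \<le> 4 * chebyshev_rate \<kappa> ^ (2 * k) * (m 0 + 2 * real k * sqrt \<kappa> / b * m 1)"
  proof (rule quadrature_error)
    show "moments_on a b m" unfolding m_def by (rule B.moments_on_form[OF x_carrier])
    show "moments_on a b m'" unfolding m'_def by (rule T.moments_on_form[OF x'_solves(1)])
    show "m i = m' i" if i_range: "2 \<le> i" "i \<le> 2 * k + 1" for i
    proof -
      obtain j where j_shift: "i = j + 2" "j \<le> 2 * k - 1" using i_range by (auto simp: le_iff_add)
      show ?thesis
        unfolding m_def m'_def j_shift(1) B.mat_inv_pow_form[OF g_carrier]
          T.mat_inv_pow_form[OF c_carrier]
        by (rule gauss_quadrature_exact[OF j_shift(2)])
    qed
    show "m' 1 \<le> m 1" unfolding m_1 by (rule projected_energy_le)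
  qed (rule bounds)+
  then show ?thesis unfolding m_0 m_1 .
qed

lemma solution_norm_gap_vnorm:
  "x \<bullet> x - (mat_inv T *\<^sub>v c) \<bullet> (mat_inv T *\<^sub>v c)
    \<le> 4 * chebyshev_rate \<kappa> ^ (2 * k)
        * (vnorm g * (vnorm w + 2 * real k * sqrt \<kappa> / opnorm B * vnorm x))"
proof -
  have "x \<bullet> x = g \<bullet> w"
    using B.mat_inv_scalar_prod[OF g_carrier x_carrier] by simp
  also have "\<dots> \<le> vnorm g * vnorm w" by (rule scalar_prod_le_vnorm[OF g_carrier w_carrier])
  finally have "x \<bullet> x \<le> vnorm g * vnorm w" .
  moreover have "2 * real k * sqrt \<kappa> / b * (g \<bullet> x)
      \<le> 2 * real k * sqrt \<kappa> / opnorm B * (vnorm g * vnorm x)"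
  proof (rule mult_mono)
    show "2 * real k * sqrt \<kappa> / b \<le> 2 * real k * sqrt \<kappa> / opnorm B"
      using B.opnorm_bounds[OF n_pos] bounds by (intro divide_left_mono) auto
    show "g \<bullet> x \<le> vnorm g * vnorm x" by (rule scalar_prod_le_vnorm[OF g_carrier x_carrier])
    show "0 \<le> g \<bullet> x"
      using B.variational_le_mat_inv_form[OF zero_carrier_vec g_carrier] g_carrier mat_carrier
      by simp
    show "0 \<le> 2 * real k * sqrt \<kappa> / opnorm B"
      using B.opnorm_bounds[OF n_pos] bounds by simp
  qed
  ultimately have "x \<bullet> x + 2 * real k * sqrt \<kappa> / b * (g \<bullet> x)
      \<le> vnorm g * (vnorm w + 2 * real k * sqrt \<kappa> / opnorm B * vnorm x)"
    by (simp add: algebra_simps)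
  then have "4 * chebyshev_rate \<kappa> ^ (2 * k) * (x \<bullet> x + 2 * real k * sqrt \<kappa> / b * (g \<bullet> x))
      \<le> 4 * chebyshev_rate \<kappa> ^ (2 * k)
        * (vnorm g * (vnorm w + 2 * real k * sqrt \<kappa> / opnorm B * vnorm x))"
    using bounds chebyshev_rate_nonneg[of \<kappa>] by (intro mult_left_mono) auto
  then show ?thesis using solution_norm_gap by linarith
qed

lemma multiplier_gap:
  assumes h_solves: "h \<in> carrier_vec k" "(T + \<mu> \<cdot>\<^sub>m 1\<^sub>m k) *\<^sub>v h = c" "h \<bullet> h = x \<bullet> x"
    and psd: "psd_mat k (T + \<mu> \<cdot>\<^sub>m 1\<^sub>m k)"
  defines "\<tau> \<equiv> unit_vec k 0 \<bullet> ((mat_inv T ^\<^sub>m 3) *\<^sub>v unit_vec k 0)"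
  shows "- \<mu> \<le> 2 * (vnorm w / (vnorm g * \<tau>))
    * (1 + 2 * vnorm x * real k * sqrt \<kappa> / (vnorm w * opnorm B)) * chebyshev_rate \<kappa> ^ (2 * k)"
proof -
  have norm_g: "0 < vnorm g" by (rule vnorm_pos[OF g_carrier g_nonzero])
  have norm_w: "0 < vnorm w" by (rule vnorm_pos[OF w_carrier w_nonzero])
  have "unit_vec k 0 \<noteq> (0\<^sub>v k :: real vec)" using k_pos by simp
  then have tau_pos: "0 < \<tau>" unfolding \<tau>_def by (intro T.mat_inv_cube_form_pos) auto
  have "c \<bullet> ((mat_inv T ^\<^sub>m 3) *\<^sub>v c) = vnorm g * vnorm g * \<tau>"
    using pow_carrier_mat[OF T.mat_inv_carrier, of 3] T.mat_inv_carrier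
    by (simp add: \<tau>_def mult_mat_vec[of _ k k])
  then have "2 * (- \<mu>) * (vnorm g * vnorm g * \<tau>) \<le> x \<bullet> x - (mat_inv T *\<^sub>v c) \<bullet> (mat_inv T *\<^sub>v c)"
    using T.shifted_solution_norm_tangent[OF _ h_solves(1,2) psd] h_solves(3) by simp
  also have "\<dots> \<le> 4 * chebyshev_rate \<kappa> ^ (2 * k)
      * (vnorm g * (vnorm w + 2 * real k * sqrt \<kappa> / opnorm B * vnorm x))"
    by (rule solution_norm_gap_vnorm)
  also have "vnorm w + 2 * real k * sqrt \<kappa> / opnorm B * vnorm x
      = vnorm w * (1 + 2 * vnorm x * real k * sqrt \<kappa> / (vnorm w * opnorm B))" (is "_ = vnorm w * ?F")
    using norm_w by (simp add: field_simps)
  finally have "(2 * vnorm g) * (- \<mu> * (vnorm g * \<tau>))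
      \<le> (2 * vnorm g) * (2 * vnorm w * ?F * chebyshev_rate \<kappa> ^ (2 * k))"
    by (simp only: mult_ac)
  then have "- \<mu> * (vnorm g * \<tau>) \<le> 2 * vnorm w * ?F * chebyshev_rate \<kappa> ^ (2 * k)"
    using norm_g by (simp only: mult_le_cancel_left_pos mult_pos_pos zero_less_numeral)
  then show ?thesis using norm_g tau_pos by (simp add: pos_le_divide_eq)
qed

end

lemma (in lanczos) gltr_multiplier_gap:
  assumes pd: "pd_matrix n (B + l \<cdot>\<^sub>m 1\<^sub>m n) a b"
    and h: "h \<in> carrier_vec k" "trs_multiplier k T c \<Delta> h l'"
  defines "S \<equiv> mat_inv (B + l \<cdot>\<^sub>m 1\<^sub>m n)"
    and "\<tau> \<equiv> unit_vec k 0 \<bullet> ((mat_inv (T + l \<cdot>\<^sub>m 1\<^sub>m k) ^\<^sub>m 3) *\<^sub>v unit_vec k 0)"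
  assumes norm: "vnorm (Q *\<^sub>v h) = vnorm (S *\<^sub>v g)"
  shows "l - l' \<le> 2 * (vnorm (S *\<^sub>v (S *\<^sub>v g)) / (vnorm g * \<tau>))
    * (1 + 2 * vnorm (S *\<^sub>v g) * real k * sqrt (b / a)
        / (vnorm (S *\<^sub>v (S *\<^sub>v g)) * opnorm (B + l \<cdot>\<^sub>m 1\<^sub>m n)))
    * chebyshev_rate (b / a) ^ (2 * k)"
proof -
  interpret shifted: pd_lanczos n k "B + l \<cdot>\<^sub>m 1\<^sub>m n" g q a b
    using lanczos_shift pd by (rule pd_lanczos.intro)
  have "(- h) \<bullet> (- h) = (S *\<^sub>v g) \<bullet> (S *\<^sub>v g)"
    using Q_isometry[OF h(1) h(1)] norm h(1) by (simp add: vnorm_uminus flip: vnorm_sq)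
  then show ?thesis
    using shifted.multiplier_gap[of "- h" "l' - l"] gltr_multiplier_shift[OF h, of l] h(1)
    by (simp add: S_def \<tau>_def T_shift)
qed

section \<open>The eigenvectors of M and the multiplier bound\<close>

lemma outer_product_mult_vec:
  fixes u v z :: "'a::comm_semiring_0 vec"
  assumes "u \<in> carrier_vec n" "v \<in> carrier_vec m" "z \<in> carrier_vec m"
  shows "mat n m (\<lambda>(i, j). u $ i * v $ j) *\<^sub>v z = (v \<bullet> z) \<cdot>\<^sub>v u"
  using assms
  by (intro eq_vecI) (auto simp: scalar_prod_def sum_distrib_left sum_distrib_right mult_ac)

lemma Mmat_mult_append:
  assumes A_carrier: "A \<in> carrier_mat n n" and g_carrier: "g \<in> carrier_vec n"
    and parts_carrier: "y1 \<in> carrier_vec n" "y2 \<in> carrier_vec n"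
  shows "Mmat n A g \<Delta> *\<^sub>v (y1 @\<^sub>v y2) = (- (A *\<^sub>v y1) + ((g \<bullet> y2) / \<Delta>\<^sup>2) \<cdot>\<^sub>v g) @\<^sub>v (y1 + - (A *\<^sub>v y2))"
proof -
  let ?G = "mat n n (\<lambda>(i, j). g $ i * g $ j)"
  have "((1 / \<Delta>\<^sup>2) \<cdot>\<^sub>m ?G) *\<^sub>v y2 = (1 / \<Delta>\<^sup>2) \<cdot>\<^sub>v (?G *\<^sub>v y2)"
    using parts_carrier by (intro eq_vecI) auto
  then have "((1 / \<Delta>\<^sup>2) \<cdot>\<^sub>m ?G) *\<^sub>v y2 = ((g \<bullet> y2) / \<Delta>\<^sup>2) \<cdot>\<^sub>v g"
    using g_carrier parts_carrier by (simp add: outer_product_mult_vec[of _ n] smult_smult_assoc)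
  then show ?thesis
    unfolding Mmat_def
    using four_block_mat_mult_vec[of "- A" n n _ n "1\<^sub>m n" n "- A" y1 y2] A_carrier parts_carrier
    by simp
qed

lemma Mmat_eigenvector_parts:
  assumes A_carrier: "A \<in> carrier_mat n n" and g_carrier: "g \<in> carrier_vec n"
    and y_eigen: "y \<in> carrier_vec (2 * n)" "Mmat n A g \<Delta> *\<^sub>v y = l \<cdot>\<^sub>v y"
  obtains s where "(A + l \<cdot>\<^sub>m 1\<^sub>m n) *\<^sub>v vec_last y n = vec_first y n"
    and "(A + l \<cdot>\<^sub>m 1\<^sub>m n) *\<^sub>v vec_first y n = s \<cdot>\<^sub>v g"
proof
  define y1 where "y1 = vec_first y n"
  define y2 where "y2 = vec_last y n"
  let ?s = "(g \<bullet> y2) / \<Delta>\<^sup>2"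
  have parts_carrier: "y1 \<in> carrier_vec n" "y2 \<in> carrier_vec n" by (simp_all add: y1_def y2_def)
  have y_eq: "y = y1 @\<^sub>v y2" using y_eigen(1) by (simp add: y1_def y2_def mult_2)
  have "l \<cdot>\<^sub>v (y1 @\<^sub>v y2) = (l \<cdot>\<^sub>v y1) @\<^sub>v (l \<cdot>\<^sub>v y2)" by (intro eq_vecI) auto
  then have block_eqs: "l \<cdot>\<^sub>v y1 = - (A *\<^sub>v y1) + ?s \<cdot>\<^sub>v g" "l \<cdot>\<^sub>v y2 = y1 + - (A *\<^sub>v y2)"
    using y_eigen(2) append_vec_eq[of _ n "l \<cdot>\<^sub>v y1"] A_carrier g_carrier parts_carrier
    unfolding y_eq Mmat_mult_append[OF A_carrier g_carrier parts_carrier] by auto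
  have "A *\<^sub>v y1 + l \<cdot>\<^sub>v y1 = ?s \<cdot>\<^sub>v g" "A *\<^sub>v y2 + l \<cdot>\<^sub>v y2 = y1"
    unfolding block_eqs using A_carrier g_carrier parts_carrier by (auto intro!: eq_vecI)
  then show "(A + l \<cdot>\<^sub>m 1\<^sub>m n) *\<^sub>v vec_last y n = vec_first y n"
    "(A + l \<cdot>\<^sub>m 1\<^sub>m n) *\<^sub>v vec_first y n = ?s \<cdot>\<^sub>v g"
    using A_carrier parts_carrier by (simp_all add: shift_mult_vec y1_def y2_def)
qed

lemma (in pd_matrix) Mmat_eigenvector_of_solutions:
  assumes A_carrier: "A \<in> carrier_mat n n" and shift: "C = A + l \<cdot>\<^sub>m 1\<^sub>m n"
    and g_carrier: "g \<in> carrier_vec n"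
    and y_eigen: "y \<in> carrier_vec (2 * n)" "Mmat n A g \<Delta> *\<^sub>v y = l \<cdot>\<^sub>v y" "vnorm y \<noteq> 0"
  obtains s where "s \<noteq> 0" "vec_first y n = s \<cdot>\<^sub>v (mat_inv C *\<^sub>v g)"
    and "vec_last y n = s \<cdot>\<^sub>v (mat_inv C *\<^sub>v (mat_inv C *\<^sub>v g))"
proof -
  obtain s where s_parts: "C *\<^sub>v vec_last y n = vec_first y n"
    "C *\<^sub>v vec_first y n = s \<cdot>\<^sub>v g"
    using Mmat_eigenvector_parts[OF A_carrier g_carrier y_eigen(1,2)] unfolding shift .
  have first: "vec_first y n = s \<cdot>\<^sub>v (mat_inv C *\<^sub>v g)"
    using mat_inv_mult_vec[of "vec_first y n"] mat_inv_carrier g_carrier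
    by (simp add: s_parts(2) mult_mat_vec[of _ n n])
  have last: "vec_last y n = s \<cdot>\<^sub>v (mat_inv C *\<^sub>v (mat_inv C *\<^sub>v g))"
    using mat_inv_mult_vec[of "vec_last y n"] mat_inv_carrier g_carrier
    by (simp add: s_parts(1) first mult_mat_vec[of _ n n])
  have "s \<noteq> 0"
  proof
    assume "s = 0"
    then have "vec_first y n = 0\<^sub>v n" "vec_last y n = 0\<^sub>v n"
      using first last mat_inv_carrier g_carrier by (auto intro: eq_vecI)
    then have "y = 0\<^sub>v n @\<^sub>v 0\<^sub>v n"
      using vec_first_last_append[of y n n] y_eigen(1) by (simp add: mult_2)
    then show False using y_eigen(3) by (simp add: vnorm_def scalar_prod_append[of _ n _ n])
  qed
  then show ?thesis using that first last by blast
qed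

theorem theorem5p9:
  fixes n k :: nat and A :: "real mat" and g :: "real vec" and \<Delta> :: real
    and x_opt :: "real vec" and lam_opt :: real
    and q :: "nat \<Rightarrow> real vec" and h :: "real vec" and lam_k :: real
    and y :: "real vec"
  assumes A_sym: "symmetric_mat n A"
    and g: "g \<in> carrier_vec n" "g \<noteq> 0\<^sub>v n"
    and \<Delta>: "\<Delta> > 0"
    and opt: "trs_global_min n A g \<Delta> x_opt" "trs_multiplier n A g \<Delta> x_opt lam_opt"
    and easy: "lam_opt > - min_eig A"
    and k: "1 \<le> k" "k \<le> kmax n A g"
    and lanczos: "lanczos_vecs n A g k q"
    and gltr: "trs_global_min k (Tmat n k q A) (vnorm g \<cdot>\<^sub>v unit_vec k 0) \<Delta> h"
              "trs_multiplier k (Tmat n k q A) (vnorm g \<cdot>\<^sub>v unit_vec k 0) \<Delta> h lam_k"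
    and bnd: "vnorm x_opt = \<Delta>" "vnorm (Qmat n k q *\<^sub>v h) = \<Delta>"
    and y: "y \<in> carrier_vec (2 * n)" "Mmat n A g \<Delta> *\<^sub>v y = lam_opt \<cdot>\<^sub>v y" "vnorm y = 1"
  shows
   "let A_opt = A + lam_opt \<cdot>\<^sub>m 1\<^sub>m n;
        kappa = (max_eig A + lam_opt) / (min_eig A + lam_opt);
        y1 = vec_first y n; y2 = vec_last y n;
        T = Tmat n k q A;
        e1 = unit_vec k 0;
        s_k = vnorm (mat_inv A_opt *\<^sub>v x_opt) /
              (vnorm g * (e1 \<bullet> ((mat_inv (T + lam_opt \<cdot>\<^sub>m 1\<^sub>m k) ^\<^sub>m 3) *\<^sub>v e1)))
    in lam_opt - lam_k \<le> 2 * s_k * (1 + 2 * vnorm y1 * real k * sqrt kappa / (vnorm y2 * opnorm A_opt))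
                         * ((sqrt kappa - 1) / (sqrt kappa + 1)) ^ (2 * k)"
proof -
  define B where "B = A + lam_opt \<cdot>\<^sub>m 1\<^sub>m n"
  define x where "x = mat_inv B *\<^sub>v g"
  let ?\<kappa> = "(max_eig A + lam_opt) / (min_eig A + lam_opt)"
  interpret lanczos n k A g q
    using A_sym g k(1) lanczos by unfold_locales
  interpret B: pd_matrix n B "min_eig A + lam_opt" "max_eig A + lam_opt"
    unfolding B_def using A_sym n_pos easy by (rule pd_matrix_eig_shift)
  obtain s where y_parts: "s \<noteq> 0" "vec_first y n = s \<cdot>\<^sub>v x"
    "vec_last y n = s \<cdot>\<^sub>v (mat_inv B *\<^sub>v x)"
    using B.Mmat_eigenvector_of_solutions[OF mat_carrier B_def g(1) y(1,2)] y(3)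
    unfolding x_def by auto
  have x_opt: "x_opt = - x"
    unfolding x_def using opt by (intro B.trs_multiplier_solution) (auto simp: trs_global_min_def B_def)
  have "lam_opt - lam_k \<le> 2 * (vnorm (mat_inv B *\<^sub>v x)
        / (vnorm g * (unit_vec k 0 \<bullet> ((mat_inv (T + lam_opt \<cdot>\<^sub>m 1\<^sub>m k) ^\<^sub>m 3) *\<^sub>v unit_vec k 0))))
      * (1 + 2 * vnorm x * real k * sqrt ?\<kappa> / (vnorm (mat_inv B *\<^sub>v x) * opnorm B))
      * chebyshev_rate ?\<kappa> ^ (2 * k)"
    unfolding B_def x_def using gltr bnd B.pd_matrix_axioms
    by (intro gltr_multiplier_gap) (auto simp: trs_global_min_def x_opt x_def B_def vnorm_uminus)
  then show ?thesis
    unfolding Let_def y_parts(2,3) x_opt B_def[symmetric] vnorm_smult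
    using y_parts(1) B.mat_inv_carrier g
    by (simp add: chebyshev_rate_def mult_mat_vec_uminus x_def vnorm_uminus mult.assoc)
qed

end
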